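(* For all integers $k \geq 2$ and $d,t \geq 1$ there is a constant $c_1=c_1(d,k,t)$ such that for every $n$, $$R^{d,t}_{k}(n) \leq \mathrm{twr}_{k-1}\left(n^{c_1}\right).$$
   Context: The tower function is defined by $\mathrm{twr}_1(x)=x$ and $\mathrm{twr}_{i+1}(x)=2^{\mathrm{twr}_i(x)}$. Let $P=\{p_1,\dots,p_N\}$ be an ordered set of points in $\mathbb{R}^d$ and let $\binom{P}{k}$ denote the set of $k$-tuples $(p_{i_1},\dots,p_{i_k})$ with $i_1<\dots<i_k$. A relation $E\subset\binom{P}{k}$ is semi-algebraic of complexity at most $t$ if there are polynomials $f_1,\dots,f_t\in\mathbb{R}[x_1,\dots,x_{dk}]$ of degree at most $t$ and a Boolean function $\Phi$ such that, with $E^*=\{x\in\mathbb{R}^{dk}:\Phi(f_1(x)\ge 0,\dots,f_t(x)\ge 0)=1\}$, we have $(p_{i_1},\dots,p_{i_k})\in E$ iff $(p_{i_1},\dots,p_{i_k})\in E^*$ for all $i_1<\dots<i_k$. A subset $S\subset P$ is homogeneous if $\binom{S}{k}\subset E$ or $\binom{S}{k}\cap E=\emptyset$; $\mathrm{hom}(P,E)$ is the largest size of a homogeneous subset. $R^{d,t}_k(n)$ is the minimum $N$ such that every ordered $N$-element point set $P\subset\mathbb{R}^d$ with every $k$-ary semi-algebraic relation $E\subset\binom{P}{k}$ of complexity at most $t$ satisfies $\mathrm{hom}(P,E)\ge n$. *)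

theory Defs
  imports
    "HOL-Analysis.Analysis"
    "HOL-Library.Poly_Mapping"
    "HOL-Library.Sublist"
    "HOL-Library.Ramsey"
begin

text \<open>Indexed from 1, as in the literature; the value at index 0 is left unspecified.\<close>

fun twr :: "nat \<Rightarrow> real \<Rightarrow> real" where
  "twr (Suc 0) x = x"
| "twr (Suc (Suc i)) x = 2 powr twr (Suc i) x"

text \<open>
  Real polynomials in variables of type \<open>'v\<close>: finitely supported maps from monomials
  (themselves finitely supported exponent vectors) to coefficients.
\<close>

type_synonym 'v mpoly = "('v \<Rightarrow>\<^sub>0 nat) \<Rightarrow>\<^sub>0 real"

definition mpoly_eval :: "('v \<Rightarrow> real) \<Rightarrow> 'v mpoly \<Rightarrow> real" where
  "mpoly_eval a p =
     (\<Sum>m\<in>Poly_Mapping.keys p. Poly_Mapping.lookup p m *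
        (\<Prod>v\<in>Poly_Mapping.keys m. a v ^ Poly_Mapping.lookup m v))"

definition mpoly_vars :: "'v mpoly \<Rightarrow> 'v set" where
  "mpoly_vars p = (\<Union>m\<in>Poly_Mapping.keys p. Poly_Mapping.keys m)"

definition mpoly_degree :: "'v mpoly \<Rightarrow> nat" where
  "mpoly_degree p =
     Max (insert 0 ((\<lambda>m. \<Sum>v\<in>Poly_Mapping.keys m. Poly_Mapping.lookup m v) ` Poly_Mapping.keys p))"

text \<open>
  An ordered \<open>N\<close>-element point set is a distinct list of length \<open>N\<close>.  Its \<open>k\<close>-tuples with increasing
  indices are its sublists of length \<open>k\<close>, and its subsets, with the inherited order, are its sublists.
\<close>

definition ktuples :: "'a list \<Rightarrow> nat \<Rightarrow> 'a list set" where
  "ktuples P k = {xs. subseq xs P \<and> length xs = k}"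

text \<open>
  A point of \<open>\<real>\<^sup>d\<^sup>k\<close> is a list of \<open>k\<close> points of \<open>\<real>\<^sup>d\<close>.  The \<open>dk\<close> variables are the pairs \<open>(i, j)\<close>
  with \<open>i < k\<close> and \<open>j :: 'd\<close>; the variable \<open>(i, j)\<close> is the \<open>j\<close>-th coordinate of the \<open>i\<close>-th point.
\<close>

definition semialg_set ::
  "nat \<Rightarrow> (nat \<times> 'd) mpoly list \<Rightarrow> (bool list \<Rightarrow> bool) \<Rightarrow> (real ^ 'd) list set" where
  "semialg_set k fs \<Phi> =
     {xs. length xs = k \<and> \<Phi> (map (\<lambda>f. mpoly_eval (\<lambda>(i, j). (xs ! i) $ j) f \<ge> 0) fs)}"

definition semialg_relation ::
  "nat \<Rightarrow> nat \<Rightarrow> (real ^ 'd) list \<Rightarrow> (real ^ 'd) list set \<Rightarrow> bool" where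
  "semialg_relation k t P E \<longleftrightarrow>
     E \<subseteq> ktuples P k \<and>
     (\<exists>(fs :: (nat \<times> 'd) mpoly list) (\<Phi> :: bool list \<Rightarrow> bool).
        length fs = t \<and>
        (\<forall>f\<in>set fs. mpoly_vars f \<subseteq> {..<k} \<times> UNIV \<and> mpoly_degree f \<le> t) \<and>
        (\<forall>xs\<in>ktuples P k. xs \<in> E \<longleftrightarrow> xs \<in> semialg_set k fs \<Phi>))"

definition homogeneous :: "nat \<Rightarrow> 'a list set \<Rightarrow> 'a list \<Rightarrow> bool" where
  "homogeneous k E S \<longleftrightarrow> ktuples S k \<subseteq> E \<or> ktuples S k \<inter> E = {}"

definition hom_size :: "nat \<Rightarrow> 'a list \<Rightarrow> 'a list set \<Rightarrow> nat" where
  "hom_size k P E = Max {length S |S. subseq S P \<and> homogeneous k E S}"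

text \<open>The dimension \<open>d\<close> is \<open>CARD('d)\<close>; the type argument serves only to fix it.\<close>

definition semialg_ramsey_bound :: "'d::finite itself \<Rightarrow> nat \<Rightarrow> nat \<Rightarrow> nat \<Rightarrow> nat \<Rightarrow> bool" where
  "semialg_ramsey_bound T t k n N \<longleftrightarrow>
     (\<forall>(P :: (real ^ 'd) list) E.
        distinct P \<and> length P = N \<and> semialg_relation k t P E \<longrightarrow> hom_size k P E \<ge> n)"

definition semialg_ramsey :: "'d::finite itself \<Rightarrow> nat \<Rightarrow> nat \<Rightarrow> nat \<Rightarrow> nat" where
  "semialg_ramsey T t k n = (LEAST N. semialg_ramsey_bound T t k n N)"

lemma finite_homogeneous_lengths:
  "finite {length S |S. subseq S P \<and> homogeneous k E S}"
proof (rule finite_subset)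
  show "{length S |S. subseq S P \<and> homogeneous k E S} \<subseteq> {..length P}"
    by (auto dest: list_emb_length)
qed simp

lemma hom_size_ge:
  assumes "subseq S P" "homogeneous k E S"
  shows "length S \<le> hom_size k P E"
  unfolding hom_size_def
  by (rule Max_ge[OF finite_homogeneous_lengths]) (use assms in blast)

lemma subseq_distinct_eq_filter:
  assumes "distinct P" "subseq xs P"
  shows "xs = filter (\<lambda>p. p \<in> set xs) P"
proof -
  obtain I where I: "xs = nths P I"
    using assms(2) subseq_conv_nths by blast
  show ?thesis
    unfolding I using filter_in_nths[OF assms(1), of I] by simp
qed

text \<open>The minimum defining \<^const>\<open>semialg_ramsey\<close> is attained, by Ramsey's theorem.\<close>

lemma semialg_ramsey_bound_exists: "\<exists>N. semialg_ramsey_bound TYPE('d::finite) t k n N"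
proof -
  obtain N :: nat where N: "partn_lst {..<N} [n, n] k"
    using ramsey_full by blast
  have "n \<le> hom_size k P E"
    if P: "distinct P" "length P = N" for P :: "(real ^ 'd) list" and E
  proof -
    define g where "g K = filter (\<lambda>p. p \<in> (!) P ` K) P" for K
    define f where "f K = (if g K \<in> E then 0 else 1 :: nat)" for K
    have inj: "inj_on ((!) P) {..<N}"
      using P by (simp add: inj_on_nth)
    have "f \<in> nsets {..<N} k \<rightarrow> {..<length [n, n]}"
      by (auto simp: f_def)
    then obtain i H where i: "i < length [n, n]" and H: "H \<in> nsets {..<N} ([n, n] ! i)"
      and mono: "f ` nsets H k \<subseteq> {i}"
      using N unfolding partn_lst_def monochromatic_def by blast
    have cardH: "card H = n" and subH: "H \<subseteq> {..<N}"
      using i H by (auto simp: nsets_def less_Suc_eq)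
    have set_g: "set (g K) = (!) P ` K" if "K \<subseteq> {..<N}" for K
      using that P by (auto simp: g_def)
    have "length (g H) = card (set (g H))"
      using P by (simp add: g_def distinct_card[symmetric])
    also have "\<dots> = n"
      using set_g[OF subH] card_image[OF inj_on_subset[OF inj subH]] cardH by simp
    finally have len: "length (g H) = n" .
    have tup: "\<exists>K\<in>nsets H k. xs = g K" if xs: "xs \<in> ktuples (g H) k" for xs
    proof -
      have sub: "subseq xs (g H)" and lxs: "length xs = k"
        using xs by (auto simp: ktuples_def)
      have subP: "subseq xs P"
        using sub subseq_order.order_trans subseq_filter_left unfolding g_def by blast
      have dxs: "distinct xs"
        using subP P by (metis subseq_conv_nths distinct_nthsI)
      define K where "K = {j \<in> H. P ! j \<in> set xs}"
      have "set xs \<subseteq> (!) P ` H"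
        using sub set_g[OF subH] by (auto simp: subseq_conv_nths dest: in_set_nthsD)
      then have imK: "(!) P ` K = set xs"
        by (auto simp: K_def)
      have KH: "K \<subseteq> H" by (auto simp: K_def)
      have "card K = k"
        using card_image[OF inj_on_subset[OF inj subset_trans[OF KH subH]]] imK
          distinct_card[OF dxs] lxs by simp
      moreover have "finite K"
        using finite_subset[OF subset_trans[OF KH subH]] by simp
      moreover have "xs = g K"
        unfolding g_def imK by (rule subseq_distinct_eq_filter) (use P subP in auto)
      ultimately show ?thesis
        using KH by (auto simp: nsets_def)
    qed
    have "homogeneous k E (g H)"
    proof (cases "i = 0")
      case True
      then have "g K \<in> E" if "K \<in> nsets H k" for K
        using mono that by (force simp: f_def split: if_splits)
      then show ?thesis using tup by (auto simp: homogeneous_def)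
    next
      case False
      then have "g K \<notin> E" if "K \<in> nsets H k" for K
        using mono that by (force simp: f_def split: if_splits)
      then show ?thesis using tup by (fastforce simp: homogeneous_def)
    qed
    then show ?thesis
      using hom_size_ge[of "g H" P k E] len by (simp add: g_def)
  qed
  then show ?thesis
    unfolding semialg_ramsey_bound_def by blast
qed

lemma semialg_ramsey_attained:
  "semialg_ramsey_bound TYPE('d::finite) t k n (semialg_ramsey TYPE('d) t k n)"
  unfolding semialg_ramsey_def by (rule LeastI_ex[OF semialg_ramsey_bound_exists])

end

theory Submission
  imports Defs
begin

text \<open>
  A polynomial of degree at most \<open>t\<close> in \<open>k\<close> points is multilinear in the vectors of monomials of the
  single points, and losing in the exponents is free, so no real algebraic geometry is needed: only
  sign conditions \<open>0 \<le> \<langle>a, b\<rangle>\<close> of vectors in a fixed \<open>\<real>\<^sup>D\<close> matter.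

  For \<open>k = 2\<close>, a relation \<open>0 \<le> \<langle>a\<^sub>i, b\<^sub>j\<rangle>\<close> that holds for a positive fraction of \<open>A \<times> B\<close> holds on
  \<open>A' \<times> B'\<close> for some linear-sized \<open>A'\<close>, \<open>B'\<close>. The induction on \<open>D\<close> reads the relation as \<open>h\<^sub>j(i) \<le> a\<^sub>i(D)\<close>,
  picks one \<open>p\<close> that for many \<open>i\<close> satisfies it while many other \<open>j\<close> have \<open>h\<^sub>j(i) \<le> h\<^sub>p(i)\<close>, and passes to
  this last relation, which lives in \<open>\<real>\<^bsup>D-1\<^esup>\<close>. Splitting an ordered set into halves and recursing gives
  homogeneous sets of polynomial size, one relation at a time.

  For the step from \<open>k\<close> to \<open>k + 1\<close>, the greedy Erdos-Rado argument picks points one by one and keeps the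
  largest class of later points that all tuples of picked points see alike. Since \<open>s\<close> vectors of \<open>\<real>\<^sup>D\<close>
  induce only polynomially many sign patterns, \<open>2\<close> to a power of \<open>M\<close> points suffice for \<open>M\<close> picks, so each
  step costs a single exponential.
\<close>

section \<open>Rectangles in relations of bounded sign rank\<close>

text \<open>Vectors are functions on all naturals of which only the entries below \<open>D\<close>
  count, so dropping or adding a coordinate changes no type.\<close>

definition dot :: "nat \<Rightarrow> (nat \<Rightarrow> real) \<Rightarrow> (nat \<Rightarrow> real) \<Rightarrow> real" where
  "dot D a b = (\<Sum>m<D. a m * b m)"

definition edge_count :: "('i \<Rightarrow> 'j \<Rightarrow> bool) \<Rightarrow> 'i set \<Rightarrow> 'j set \<Rightarrow> nat" where
  "edge_count R A B = (\<Sum>i\<in>A. card {j\<in>B. R i j})"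

definition has_rectangle :: "real \<Rightarrow> ('i \<Rightarrow> 'j \<Rightarrow> bool) \<Rightarrow> 'i set \<Rightarrow> 'j set \<Rightarrow> bool" where
  "has_rectangle \<epsilon> R A B \<longleftrightarrow>
     (\<exists>A'\<subseteq>A. \<exists>B'\<subseteq>B. \<epsilon> * card A \<le> card A' \<and> \<epsilon> * card B \<le> card B' \<and> (\<forall>i\<in>A'. \<forall>j\<in>B'. R i j))"

lemma dot_Suc: "dot (Suc D) a b = dot D a b + a D * b D"
  by (simp add: dot_def)

text \<open>Comparing two thresholds \<open>- dot D a b / c\<close> and
  \<open>- dot D a b' / c'\<close> is thereby again a sign condition, now without the last
  coordinate.\<close>

lemma dot_diff_divide: "dot D a (\<lambda>m. b m / c - b' m / c') = dot D a b / c - dot D a b' / c'"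
  by (simp add: dot_def sum_divide_distrib right_diff_distrib sum_subtractf)

lemma dot_diff_divide_left: "dot D (\<lambda>m. b m / c - b' m / c') a = dot D b a / c - dot D b' a / c'"
  by (simp add: dot_def sum_divide_distrib left_diff_distrib sum_subtractf)

text \<open>Fractions multiply when a rectangle is found inside large subsets, and the relation may
  be exchanged as long as the implication holds on those subsets.\<close>

lemma has_rectangle_mono:
  fixes \<alpha> \<beta> \<epsilon> \<eta> :: real
  assumes "has_rectangle \<epsilon> R A' B'" "A' \<subseteq> A" "B' \<subseteq> B"
    "\<alpha> * card A \<le> card A'" "\<beta> * card B \<le> card B'"
    "\<eta> \<le> \<epsilon> * \<alpha>" "\<eta> \<le> \<epsilon> * \<beta>" "0 \<le> \<epsilon>"
    "\<And>i j. i \<in> A' \<Longrightarrow> j \<in> B' \<Longrightarrow> R i j \<Longrightarrow> S i j"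
  shows "has_rectangle \<eta> S A B"
proof -
  obtain A'' B'' where *: "A'' \<subseteq> A'" "B'' \<subseteq> B'" "\<epsilon> * card A' \<le> card A''" "\<epsilon> * card B' \<le> card B''"
    "\<forall>i\<in>A''. \<forall>j\<in>B''. R i j"
    using assms(1) unfolding has_rectangle_def by blast
  have "\<eta> * card A \<le> (\<epsilon> * \<alpha>) * card A" using assms(6) by (intro mult_right_mono) auto
  also have "\<dots> \<le> \<epsilon> * card A'" using mult_left_mono[OF assms(4,8)] by (simp add: mult.assoc)
  finally have 1: "\<eta> * card A \<le> card A''" using *(3) by linarith
  have "\<eta> * card B \<le> (\<epsilon> * \<beta>) * card B" using assms(7) by (intro mult_right_mono) auto
  also have "\<dots> \<le> \<epsilon> * card B'" using mult_left_mono[OF assms(5,8)] by (simp add: mult.assoc)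
  finally have 2: "\<eta> * card B \<le> card B''" using *(4) by linarith
  have "A'' \<subseteq> A" "B'' \<subseteq> B" "\<forall>i\<in>A''. \<forall>j\<in>B''. S i j" using * assms(2,3,9) by blast+
  with 1 2 show ?thesis unfolding has_rectangle_def by blast
qed

text \<open>Averaging: for nonnegative \<open>\<delta>\<close>, elements with \<open>f i\<close>
  below \<open>\<delta> / 2 * n\<close> contribute at most half of the guaranteed total, and every
  other element at most \<open>n\<close>.\<close>

lemma many_popular:
  fixes f :: "'i \<Rightarrow> nat" and \<delta> :: real
  assumes "finite A" and le: "\<And>i. i \<in> A \<Longrightarrow> f i \<le> n" and "0 < n"
    and total: "\<delta> * card A * n \<le> (\<Sum>i\<in>A. f i)"
  shows "\<delta> / 2 * card A \<le> card {i\<in>A. \<delta> / 2 * n \<le> f i}"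
proof -
  let ?A1 = "{i\<in>A. \<delta> / 2 * n \<le> f i}"
  have "0 \<le> \<delta> \<or> \<delta> < 0" by linarith
  then show ?thesis
  proof
    assume d: "0 \<le> \<delta>"
    have "real (\<Sum>i\<in>A. f i) \<le> (\<Sum>i\<in>A. (if i \<in> ?A1 then real n else 0) + \<delta> / 2 * n)"
      unfolding of_nat_sum
    proof (rule sum_mono)
      fix i assume "i \<in> A"
      moreover have "0 \<le> \<delta> / 2 * n" using d by simp
      ultimately show "real (f i) \<le> (if i \<in> ?A1 then real n else 0) + \<delta> / 2 * n"
        using le[of i] by (auto simp: not_le add_increasing2)
    qed
    also have "\<dots> = real n * card ?A1 + card A * (\<delta> / 2 * n)"
      using assms(1) by (simp add: sum.distrib sum.If_cases Int_def)
    finally have "n * (\<delta> / 2 * card A) \<le> real n * card ?A1"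
      using total by (simp add: field_simps)
    then show ?thesis using assms(3) by simp
  next
    assume "\<delta> < 0"
    then have "\<delta> / 2 * card A \<le> 0" by (simp add: mult_nonpos_nonneg)
    then show ?thesis by (rule order_trans) simp
  qed
qed

text \<open>Positivity of \<open>b j D\<close> turns the relation into
  \<open>h i j \<le> a i D\<close>. By transitivity it follows from
  \<open>h i j \<le> h i j0\<close> whenever \<open>j0\<close> is itself related to
  \<open>i\<close>, and this comparison is a sign condition in dimension \<open>D\<close>. The work
  lies in finding one \<open>j0\<close> that keeps many \<open>i\<close> and a dense
  comparison.\<close>

lemma has_rectangle_pos_step:
  fixes a :: "'i \<Rightarrow> nat \<Rightarrow> real" and b :: "'j \<Rightarrow> nat \<Rightarrow> real" and \<delta> \<epsilon> :: real
  assumes IH: "\<And>(a :: 'i \<Rightarrow> nat \<Rightarrow> real) (b :: 'j \<Rightarrow> nat \<Rightarrow> real) A B.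
      finite A \<Longrightarrow> finite B \<Longrightarrow>
      \<delta> / 4 * card A * card B \<le> edge_count (\<lambda>i j. 0 \<le> dot D (a i) (b j)) A B \<Longrightarrow>
      has_rectangle \<epsilon> (\<lambda>i j. 0 \<le> dot D (a i) (b j)) A B"
    and fin: "finite A" "finite B" and pos: "\<And>j. j \<in> B \<Longrightarrow> 0 < b j D"
    and \<delta>: "0 < \<delta>" "\<delta> \<le> 1" and \<epsilon>: "0 < \<epsilon>" "\<epsilon> \<le> 1"
    and dense: "\<delta> * card A * card B \<le> edge_count (\<lambda>i j. 0 \<le> dot (Suc D) (a i) (b j)) A B"
  shows "has_rectangle (\<epsilon> * \<delta>\<^sup>2 / 8) (\<lambda>i j. 0 \<le> dot (Suc D) (a i) (b j)) A B"
proof (cases "B = {}")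
  case True
  have "\<epsilon> * \<delta>\<^sup>2 \<le> 1" using \<delta> \<epsilon> by (intro mult_le_one power_le_one) auto
  then have "(\<epsilon> * \<delta>\<^sup>2 / 8) * card A \<le> 1 * real (card A)" by (intro mult_right_mono) auto
  with True show ?thesis unfolding has_rectangle_def
    by (intro exI[of _ A] exI[of _ B]) auto
next
  case False
  define h where "h i j = - dot D (a i) (b j) / b j D" for i j
  have above: "0 \<le> dot (Suc D) (a i) (b j) \<longleftrightarrow> h i j \<le> a i D" if "j \<in> B" for i j
    using pos[OF that] by (simp add: h_def dot_Suc field_simps) linarith
  have compare: "0 \<le> dot D (a i) (\<lambda>m. b j m / b j D - b j0 m / b j0 D) \<longleftrightarrow> h i j \<le> h i j0"
    for i j j0
    by (simp add: h_def dot_diff_divide)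
  \<comment> \<open>Half of the average density is kept for each single \<open>i\<close>; the other
    half is given up in \<open>many_popular\<close>.\<close>
  define A1 where "A1 = {i\<in>A. \<delta> / 2 * card B \<le> card {j\<in>B. h i j \<le> a i D}}"
  have cardB: "0 < card B" using False fin by (simp add: card_gt_0_iff)
  have A1: "\<delta> / 2 * card A \<le> card A1" "A1 \<subseteq> A"
  proof -
    have "edge_count (\<lambda>i j. 0 \<le> dot (Suc D) (a i) (b j)) A B = (\<Sum>i\<in>A. card {j\<in>B. h i j \<le> a i D})"
      unfolding edge_count_def by (intro sum.cong refl arg_cong[of _ _ card]) (auto simp: above)
    then show "\<delta> / 2 * card A \<le> card A1" unfolding A1_def
      using many_popular[of A "\<lambda>i. card {j\<in>B. h i j \<le> a i D}" "card B" \<delta>] dense cardB fin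
      by (simp add: card_mono)
  qed (auto simp: A1_def)
  define low where "low i j = {j'\<in>B. h i j' \<le> h i j}" for i j
  \<comment> \<open>\<open>G i\<close> collects the candidates for \<open>j0\<close> at
    \<open>i\<close>: related to \<open>i\<close>, and with many thresholds at or below their
    own.\<close>
  define G where "G i = {j\<in>B. h i j \<le> a i D \<and> \<delta> / 4 * card B \<le> card (low i j)}" for i
  have G: "\<delta> / 4 * card B \<le> card (G i)" if "i \<in> A1" for i
  proof -
    define T where "T = {j\<in>B. h i j \<le> a i D}"
    have finT: "finite T" "finite (T - G i)" using fin by (auto simp: T_def)
    \<comment> \<open>The element of \<open>T - G i\<close> with the largest threshold has all of
      \<open>T - G i\<close> below it, yet fails the lower bound on \<open>low\<close> because it is
      not in \<open>G i\<close>.\<close>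
    have "card (T - G i) \<le> \<delta> / 4 * card B"
    proof (cases "T - G i = {}")
      case True
      show ?thesis unfolding True using \<delta> by simp
    next
      case ne: False
      have "Max (h i ` (T - G i)) \<in> h i ` (T - G i)" using ne finT by (intro Max_in) auto
      then obtain j where j: "j \<in> T - G i" "h i j = Max (h i ` (T - G i))" by auto
      then have max: "h i j' \<le> h i j" if "j' \<in> T - G i" for j' using that finT by simp
      have "T - G i \<subseteq> low i j" using max by (auto simp: low_def T_def)
      then have "card (T - G i) \<le> card (low i j)" using fin by (intro card_mono) (auto simp: low_def)
      moreover have "card (low i j) < \<delta> / 4 * card B" using j(1) by (auto simp: G_def T_def)
      ultimately show ?thesis by linarith
    qed
    moreover have "\<delta> / 2 * card B \<le> card T" using that by (simp add: A1_def T_def)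
    moreover have "card T = card (G i) + card (T - G i)"
    proof -
      have "G i \<subseteq> T" by (auto simp: G_def T_def)
      then show ?thesis using finT by (simp add: card_Diff_subset card_mono finite_subset)
    qed
    ultimately show ?thesis by (simp add: field_simps)
  qed
  have finA1: "finite A1" using A1 fin finite_subset by blast
  \<comment> \<open>Double counting of the pairs with \<open>j \<in> G i\<close>: some
    \<open>j0\<close> reaches the average.\<close>
  have "\<exists>j0\<in>B. \<delta> / 4 * card A1 \<le> card {i\<in>A1. j0 \<in> G i}"
  proof (rule ccontr)
    assume "\<not> ?thesis"
    then have *: "card {i\<in>A1. j \<in> G i} < \<delta> / 4 * card A1" if "j \<in> B" for j
      using that by (simp add: not_le)
    have "(\<Sum>j\<in>B. real (card {i\<in>A1. j \<in> G i})) < (\<Sum>j\<in>B. \<delta> / 4 * card A1)"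
      using * False fin by (intro sum_strict_mono) auto
    moreover have "(\<Sum>i\<in>A1. card (G i)) = (\<Sum>j\<in>B. card {i\<in>A1. j \<in> G i})"
    proof -
      have "card (G i) = card {j\<in>B. j \<in> G i}" for i by (rule arg_cong[of _ _ card]) (auto simp: G_def)
      then show ?thesis
        using sum_multicount_gen[of A1 B "\<lambda>i j. j \<in> G i" "\<lambda>j. card {i\<in>A1. j \<in> G i}"] finA1 fin by simp
    qed
    moreover have "(\<Sum>i\<in>A1. \<delta> / 4 * card B) \<le> (\<Sum>i\<in>A1. real (card (G i)))"
      using G by (intro sum_mono) auto
    ultimately show False
      by (simp flip: of_nat_sum add: mult_ac)
  qed
  then obtain j0 where j0: "j0 \<in> B" "\<delta> / 4 * card A1 \<le> card {i\<in>A1. j0 \<in> G i}" by blast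
  define A2 where "A2 = {i\<in>A1. j0 \<in> G i}"
  define b' where "b' j m = b j m / b j D - b j0 m / b j0 D" for j m
  have rect: "has_rectangle \<epsilon> (\<lambda>i j. 0 \<le> dot D (a i) (b' j)) A2 B"
  proof (rule IH)
    have compare': "0 \<le> dot D (a i) (b' j) \<longleftrightarrow> h i j \<le> h i j0" for i j
      using compare[of i j j0] by (simp add: b'_def[abs_def])
    have "(\<Sum>i\<in>A2. \<delta> / 4 * card B) \<le> (\<Sum>i\<in>A2. real (card (low i j0)))"
      by (intro sum_mono) (auto simp: A2_def G_def)
    then show "\<delta> / 4 * card A2 * card B \<le> edge_count (\<lambda>i j. 0 \<le> dot D (a i) (b' j)) A2 B"
      by (simp add: edge_count_def compare' low_def mult_ac)
  qed (use finA1 fin in \<open>auto simp: A2_def\<close>)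
  have cardA2: "\<delta>\<^sup>2 / 8 * card A \<le> card A2"
  proof -
    have "\<delta>\<^sup>2 / 8 * card A = \<delta> / 4 * (\<delta> / 2 * card A)" by (simp add: power2_eq_square)
    also have "\<dots> \<le> \<delta> / 4 * card A1" using A1 \<delta> by (intro mult_left_mono) auto
    also have "\<dots> \<le> card A2" using j0 by (simp add: A2_def)
    finally show ?thesis .
  qed
  \<comment> \<open>The chain is \<open>h i j \<le> h i j0 \<le> a i D\<close>.\<close>
  have imp: "0 \<le> dot (Suc D) (a i) (b j)"
    if "i \<in> A2" "j \<in> B" "0 \<le> dot D (a i) (b' j)" for i j
    using that above[of j i] compare[of i j j0] by (auto simp: A2_def G_def b'_def[abs_def])
  have "\<delta>\<^sup>2 \<le> 1" using \<delta> by (simp add: power_le_one)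
  then have "\<epsilon> * \<delta>\<^sup>2 \<le> \<epsilon> * 8" using \<epsilon> by (intro mult_left_mono) auto
  then have le: "\<epsilon> * \<delta>\<^sup>2 / 8 \<le> \<epsilon> * 1" by simp
  have sub: "A2 \<subseteq> A" using A1 by (auto simp: A2_def)
  have "1 * real (card B) \<le> card B" by simp
  from has_rectangle_mono[OF rect sub order_refl cardA2 this _ le _ imp] show ?thesis
    using \<epsilon> by simp
qed

text \<open>Induction on \<open>D\<close>, for all densities at once since the density shrinks on
  the way. In dimension \<open>0\<close> every pair is related. Otherwise \<open>B\<close> is split
  by the sign of \<open>b j D\<close>, and one of the three classes keeps a third of the guaranteed
  pairs.\<close>

lemma dense_has_rectangle:
  fixes \<delta> :: real
  assumes "0 < \<delta>" "\<delta> \<le> 1"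
  shows "\<exists>\<epsilon>>0. \<epsilon> \<le> 1 \<and> (\<forall>(a :: 'i \<Rightarrow> nat \<Rightarrow> real) (b :: 'j \<Rightarrow> nat \<Rightarrow> real) A B. finite A \<longrightarrow> finite B \<longrightarrow>
      \<delta> * card A * card B \<le> edge_count (\<lambda>i j. 0 \<le> dot D (a i) (b j)) A B \<longrightarrow>
      has_rectangle \<epsilon> (\<lambda>i j. 0 \<le> dot D (a i) (b j)) A B)"
  using assms
proof (induction D arbitrary: \<delta>)
    case 0
    show ?case
      by (intro exI[of _ 1]) (auto simp: has_rectangle_def dot_def)
  next
    case (Suc D)
    \<comment> \<open>The factor \<open>3\<close> pays for the three sign classes, the further
      \<open>4\<close> for the density lost in \<open>has_rectangle_pos_step\<close>.\<close>
    have \<delta>': "0 < \<delta> / 3" "\<delta> / 3 \<le> 1" "0 < \<delta> / 3 / 4" "\<delta> / 3 / 4 \<le> 1" using Suc.prems by auto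
    obtain \<epsilon>1 where \<epsilon>1: "0 < \<epsilon>1" "\<epsilon>1 \<le> 1"
      "\<And>(a :: 'i \<Rightarrow> nat \<Rightarrow> real) (b :: 'j \<Rightarrow> nat \<Rightarrow> real) A B. finite A \<Longrightarrow> finite B \<Longrightarrow>
      \<delta> / 3 * card A * card B \<le> edge_count (\<lambda>i j. 0 \<le> dot D (a i) (b j)) A B \<Longrightarrow>
      has_rectangle \<epsilon>1 (\<lambda>i j. 0 \<le> dot D (a i) (b j)) A B"
      using Suc.IH[OF \<delta>'(1,2)] by blast
    obtain \<epsilon>2 where \<epsilon>2: "0 < \<epsilon>2" "\<epsilon>2 \<le> 1"
      "\<And>(a :: 'i \<Rightarrow> nat \<Rightarrow> real) (b :: 'j \<Rightarrow> nat \<Rightarrow> real) A B. finite A \<Longrightarrow> finite B \<Longrightarrow>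
      \<delta> / 3 / 4 * card A * card B \<le> edge_count (\<lambda>i j. 0 \<le> dot D (a i) (b j)) A B \<Longrightarrow>
      has_rectangle \<epsilon>2 (\<lambda>i j. 0 \<le> dot D (a i) (b j)) A B"
      using Suc.IH[OF \<delta>'(3,4)] by blast
    define \<epsilon>3 where "\<epsilon>3 = \<epsilon>2 * (\<delta> / 3)\<^sup>2 / 8"
    \<comment> \<open>The minimum serves all three classes, and \<open>\<delta> / 3\<close> converts
      a fraction of the class into a fraction of \<open>B\<close>.\<close>
    define \<epsilon> where "\<epsilon> = min \<epsilon>1 \<epsilon>3 * (\<delta> / 3)"
    have \<epsilon>3: "0 < \<epsilon>3" using \<epsilon>2 Suc.prems by (simp add: \<epsilon>3_def)
    have \<epsilon>: "0 < \<epsilon>" "\<epsilon> \<le> 1"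
      using \<epsilon>1 \<epsilon>3 Suc.prems mult_le_one[of "min \<epsilon>1 \<epsilon>3" "\<delta> / 3"] by (auto simp: \<epsilon>_def)
    have "has_rectangle \<epsilon> (\<lambda>i j. 0 \<le> dot (Suc D) (a i) (b j)) A B"
      if fin: "finite A" "finite B" and
        dense: "\<delta> * card A * card B \<le> edge_count (\<lambda>i j. 0 \<le> dot (Suc D) (a i) (b j)) A B"
      for a :: "'i \<Rightarrow> nat \<Rightarrow> real" and b :: "'j \<Rightarrow> nat \<Rightarrow> real" and A B
    proof (cases "A = {}")
      case True
      have "\<epsilon> * card B \<le> 1 * real (card B)" using \<epsilon> by (intro mult_right_mono) auto
      with True show ?thesis unfolding has_rectangle_def by (intro exI[of _ A] exI[of _ B]) auto
    next
      case False
      let ?R = "\<lambda>i j. 0 \<le> dot (Suc D) (a i) (b j)"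
      define Bp Bn Bz where "Bp = {j\<in>B. 0 < b j D}" and "Bn = {j\<in>B. b j D < 0}" and "Bz = {j\<in>B. b j D = 0}"
      have sub: "Bp \<subseteq> B" "Bn \<subseteq> B" "Bz \<subseteq> B" by (auto simp: Bp_def Bn_def Bz_def)
      have "card {j\<in>B. ?R i j} \<le> card {j\<in>Bp. ?R i j} + card {j\<in>Bn. ?R i j} + card {j\<in>Bz. ?R i j}" for i
      proof -
        have "{j\<in>B. ?R i j} = ({j\<in>Bp. ?R i j} \<union> {j\<in>Bn. ?R i j}) \<union> {j\<in>Bz. ?R i j}"
          by (auto simp: Bp_def Bn_def Bz_def)
        then show ?thesis by (metis (no_types, lifting) card_Un_le add_le_mono1 order_trans)
      qed
      then have split: "edge_count ?R A B \<le> edge_count ?R A Bp + edge_count ?R A Bn + edge_count ?R A Bz"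
        unfolding edge_count_def sum.distrib[symmetric] by (intro sum_mono)
      have "real (edge_count ?R A B) \<le> edge_count ?R A Bp + edge_count ?R A Bn + edge_count ?R A Bz"
        using split by linarith
      then have "\<exists>B'\<in>{Bp, Bn, Bz}. \<delta> / 3 * card A * card B \<le> edge_count ?R A B'"
        using dense by auto
      then obtain B' where B': "B' \<in> {Bp, Bn, Bz}" and B'_dense: "\<delta> / 3 * card A * card B \<le> edge_count ?R A B'"
        by blast
      have B'B: "B' \<subseteq> B" using B' sub by auto
      then have finB': "finite B'" using fin finite_subset by blast
      \<comment> \<open>A class that carries a \<open>\<delta> / 3\<close> share of all pairs must
        contain a \<open>\<delta> / 3\<close> share of \<open>B\<close>.\<close>
      have "edge_count ?R A B' \<le> (\<Sum>i\<in>A. card B')"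
        unfolding edge_count_def by (intro sum_mono card_mono) (auto simp: finB')
      then have "real (edge_count ?R A B') \<le> real (card A) * card B'" by (simp flip: of_nat_mult)
      with B'_dense have "real (card A) * (\<delta> / 3 * card B) \<le> real (card A) * card B'" by (simp add: mult_ac)
      then have cardB': "\<delta> / 3 * card B \<le> card B'" using False fin by (simp add: card_gt_0_iff)
      have "\<delta> / 3 * card A * card B' \<le> \<delta> / 3 * card A * card B"
        using card_mono[OF fin(2) B'B] \<delta>' by (intro mult_left_mono) auto
      then have dense': "\<delta> / 3 * card A * card B' \<le> edge_count ?R A B'"
        using B'_dense by linarith
      have lift: ?thesis if "has_rectangle \<eta> ?R A B'" "min \<epsilon>1 \<epsilon>3 \<le> \<eta>" for \<eta>
      proof (rule has_rectangle_mono[OF that(1) order_refl B'B _ cardB', where \<alpha> = 1])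
        have "0 < \<eta>" using that \<epsilon>1 \<epsilon>3 by auto
        then show "0 \<le> \<eta>" by simp
        show "\<epsilon> \<le> \<eta> * (\<delta> / 3)" unfolding \<epsilon>_def using that \<delta>' by (intro mult_right_mono) auto
        also have "\<dots> \<le> \<eta> * 1" using \<delta>' \<open>0 < \<eta>\<close> by (intro mult_left_mono) auto
        finally show "\<epsilon> \<le> \<eta> * 1" .
      qed auto
      consider "B' = Bp" | "B' = Bn" | "B' = Bz" using B' by blast
      then show ?thesis
      proof cases
        case 1
        show ?thesis
          by (rule lift[OF has_rectangle_pos_step[OF \<epsilon>2(3) fin(1) finB' _ \<delta>'(1,2) \<epsilon>2(1,2) dense']])
            (use 1 in \<open>auto simp: Bp_def \<epsilon>3_def\<close>)
      next
        case 2
        \<comment> \<open>Negating the last coordinate on both sides preserves all inner products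
          and makes \<open>b' j D\<close> positive.\<close>
        define a' where "a' i = (a i)(D := - a i D)" for i
        define b' where "b' j = (b j)(D := - b j D)" for j
        have eq: "dot (Suc D) (a' i) (b' j) = dot (Suc D) (a i) (b j)" for i j
          by (simp add: dot_def a'_def b'_def)
        have "has_rectangle (\<epsilon>2 * (\<delta> / 3)\<^sup>2 / 8) (\<lambda>i j. 0 \<le> dot (Suc D) (a' i) (b' j)) A B'"
        proof (rule has_rectangle_pos_step[OF \<epsilon>2(3) fin(1) finB' _ \<delta>'(1,2) \<epsilon>2(1,2)])
          show "0 < b' j D" if "j \<in> B'" for j using that 2 by (simp add: Bn_def b'_def)
          show "\<delta> / 3 * card A * card B' \<le> edge_count (\<lambda>i j. 0 \<le> dot (Suc D) (a' i) (b' j)) A B'"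
            unfolding eq by (rule dense')
        qed
        then show ?thesis by (intro lift) (auto simp: eq \<epsilon>3_def)
      next
        case 3
        have eq: "dot (Suc D) (a i) (b j) = dot D (a i) (b j)" if "j \<in> B'" for i j
          using that 3 by (simp add: Bz_def dot_Suc)
        have "edge_count ?R A B' = edge_count (\<lambda>i j. 0 \<le> dot D (a i) (b j)) A B'"
          unfolding edge_count_def by (intro sum.cong refl arg_cong[of _ _ card]) (auto simp: eq)
        then have "has_rectangle \<epsilon>1 (\<lambda>i j. 0 \<le> dot D (a i) (b j)) A B'"
          using \<epsilon>1(3)[OF fin(1) finB'] dense' by simp
        then have "has_rectangle \<epsilon>1 ?R A B'"
          by (rule has_rectangle_mono[where \<alpha> = 1 and \<beta> = 1]) (use \<epsilon>1 in \<open>auto simp: eq\<close>)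
        then show ?thesis by (rule lift) simp
      qed
    qed
    then show ?case using \<epsilon> by blast
qed

text \<open>The relation or its complement has density at least one half. The complement is a strict
  inequality, which on finite sets becomes a sign condition in dimension
  \<open>Suc D\<close>.\<close>

lemma has_homogeneous_rectangle:
  obtains \<epsilon> :: real where "0 < \<epsilon>" "\<epsilon> \<le> 1"
    "\<And>(a :: 'i \<Rightarrow> nat \<Rightarrow> real) (b :: 'j \<Rightarrow> nat \<Rightarrow> real) A B. finite A \<Longrightarrow> finite B \<Longrightarrow>
      has_rectangle \<epsilon> (\<lambda>i j. 0 \<le> dot D (a i) (b j)) A B \<or>
      has_rectangle \<epsilon> (\<lambda>i j. \<not> 0 \<le> dot D (a i) (b j)) A B"
proof -
  have half: "0 < (1 / 2 :: real)" "1 / 2 \<le> (1 :: real)" by auto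
  obtain \<epsilon>1 :: real where \<epsilon>1: "0 < \<epsilon>1" "\<epsilon>1 \<le> 1"
    "\<And>(a :: 'i \<Rightarrow> nat \<Rightarrow> real) (b :: 'j \<Rightarrow> nat \<Rightarrow> real) A B. finite A \<Longrightarrow> finite B \<Longrightarrow>
      1 / 2 * card A * card B \<le> edge_count (\<lambda>i j. 0 \<le> dot D (a i) (b j)) A B \<Longrightarrow>
      has_rectangle \<epsilon>1 (\<lambda>i j. 0 \<le> dot D (a i) (b j)) A B"
    using dense_has_rectangle[OF half, of D] by blast
  obtain \<epsilon>2 :: real where \<epsilon>2: "0 < \<epsilon>2" "\<epsilon>2 \<le> 1"
    "\<And>(a :: 'i \<Rightarrow> nat \<Rightarrow> real) (b :: 'j \<Rightarrow> nat \<Rightarrow> real) A B. finite A \<Longrightarrow> finite B \<Longrightarrow>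
      1 / 2 * card A * card B \<le> edge_count (\<lambda>i j. 0 \<le> dot (Suc D) (a i) (b j)) A B \<Longrightarrow>
      has_rectangle \<epsilon>2 (\<lambda>i j. 0 \<le> dot (Suc D) (a i) (b j)) A B"
    using dense_has_rectangle[OF half, of "Suc D"] by blast
  have "has_rectangle (min \<epsilon>1 \<epsilon>2) (\<lambda>i j. 0 \<le> dot D (a i) (b j)) A B \<or>
      has_rectangle (min \<epsilon>1 \<epsilon>2) (\<lambda>i j. \<not> 0 \<le> dot D (a i) (b j)) A B"
    if fin: "finite A" "finite B" for a :: "'i \<Rightarrow> nat \<Rightarrow> real" and b :: "'j \<Rightarrow> nat \<Rightarrow> real" and A B
  proof -
    let ?R = "\<lambda>i j. 0 \<le> dot D (a i) (b j)"
    \<comment> \<open>On a finite set a strict inequality has a margin \<open>\<eta>\<close>; one extra coordinate absorbs it.\<close>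
    define V where "V = insert 1 ((\<lambda>(i, j). - dot D (a i) (b j)) ` {(i, j) \<in> A \<times> B. \<not> ?R i j})"
    define \<eta> where "\<eta> = Min V"
    have "finite {(i, j) \<in> A \<times> B. \<not> ?R i j}"
      by (rule finite_subset[of _ "A \<times> B"]) (use fin in auto)
    then have finV: "finite V" by (simp add: V_def)
    have "\<eta> \<in> V" unfolding \<eta>_def by (rule Min_in) (use finV in \<open>auto simp: V_def\<close>)
    then have \<eta>_pos: "0 < \<eta>" by (auto simp: V_def)
    define a' where "a' i m = (if m = D then - \<eta> else - a i m)" for i m
    define b' where "b' j m = (if m = D then 1 else b j m)" for j m
    have dot': "dot (Suc D) (a' i) (b' j) = - dot D (a i) (b j) - \<eta>" for i j
      by (simp add: dot_def a'_def b'_def sum_negf)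
    have strict: "0 \<le> dot (Suc D) (a' i) (b' j) \<longleftrightarrow> \<not> ?R i j" if "i \<in> A" "j \<in> B" for i j
    proof
      show "\<not> ?R i j" if "0 \<le> dot (Suc D) (a' i) (b' j)" using that \<eta>_pos dot' by simp
      assume "\<not> ?R i j"
      then have "- dot D (a i) (b j) \<in> V" using that by (auto simp: V_def)
      then show "0 \<le> dot (Suc D) (a' i) (b' j)" using Min_le[OF finV] by (simp add: \<eta>_def dot')
    qed
    have "card {j\<in>B. ?R i j} + card {j\<in>B. \<not> ?R i j} = card B" for i
    proof -
      have "card {j\<in>B. ?R i j} + card {j\<in>B. \<not> ?R i j} = card ({j\<in>B. ?R i j} \<union> {j\<in>B. \<not> ?R i j})"
        using fin by (intro card_Un_disjoint[symmetric]) auto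
      also have "{j\<in>B. ?R i j} \<union> {j\<in>B. \<not> ?R i j} = B" by blast
      finally show ?thesis .
    qed
    then have "edge_count ?R A B + edge_count (\<lambda>i j. \<not> ?R i j) A B = card A * card B"
      unfolding edge_count_def by (simp flip: sum.distrib)
    then have "real (edge_count ?R A B + edge_count (\<lambda>i j. \<not> ?R i j) A B) = real (card A * card B)"
      by (rule arg_cong)
    then have total: "real (edge_count ?R A B) + edge_count (\<lambda>i j. \<not> ?R i j) A B = real (card A) * card B"
      by (simp only: of_nat_add of_nat_mult)
    have eq: "edge_count (\<lambda>i j. \<not> ?R i j) A B = edge_count (\<lambda>i j. 0 \<le> dot (Suc D) (a' i) (b' j)) A B"
      unfolding edge_count_def by (intro sum.cong refl arg_cong[of _ _ card]) (auto simp: strict)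
    show ?thesis
    proof (cases "1 / 2 * card A * card B \<le> edge_count ?R A B")
      case True
      show ?thesis
        by (rule disjI1, rule has_rectangle_mono[OF \<epsilon>1(3)[OF fin True], where \<alpha> = 1 and \<beta> = 1])
          (use \<epsilon>1 in auto)
    next
      case False
      then have *: "1 / 2 * card A * card B \<le> edge_count (\<lambda>i j. 0 \<le> dot (Suc D) (a' i) (b' j)) A B"
        using total unfolding eq by simp
      show ?thesis
        by (rule disjI2, rule has_rectangle_mono[OF \<epsilon>2(3)[OF fin *], where \<alpha> = 1 and \<beta> = 1])
          (use \<epsilon>2 strict in auto)
    qed
  qed
  moreover have "0 < min \<epsilon>1 \<epsilon>2" "min \<epsilon>1 \<epsilon>2 \<le> 1" using \<epsilon>1 \<epsilon>2 by auto
  ultimately show ?thesis using that by blast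
qed

section \<open>Polynomial Ramsey bound for pairs\<close>

lemma exists_initial_segment:
  fixes A :: "'a::linorder set"
  assumes "finite A" "n \<le> card A"
  shows "\<exists>B\<subseteq>A. card B = n \<and> (\<forall>x\<in>B. \<forall>y\<in>A - B. x < y)"
  using assms(2)
proof (induction n)
  case 0
  show ?case by (intro exI[of _ "{}"]) auto
next
  case (Suc n)
  then obtain B where B: "B \<subseteq> A" "card B = n" "\<forall>x\<in>B. \<forall>y\<in>A - B. x < y" by auto
  have ne: "A - B \<noteq> {}" using B Suc.prems by auto
  define x where "x = Min (A - B)"
  have x: "x \<in> A - B" unfolding x_def using assms(1) ne by (intro Min_in) auto
  have "x < y" if "y \<in> A - insert x B" for y
    using that assms(1) Min_le[of "A - B" y] by (auto simp: x_def less_le)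
  moreover have "card (insert x B) = Suc n" using x B assms(1) finite_subset[of B A] by auto
  ultimately show ?case using x B by (intro exI[of _ "insert x B"]) auto
qed

text \<open>Only pairs with \<open>i < j\<close> are tested, because
  \<open>dot D (a i) (b j)\<close> need not be symmetric in the indices.\<close>

definition clique_on :: "(nat \<Rightarrow> nat \<Rightarrow> bool) \<Rightarrow> nat set \<Rightarrow> bool" where
  "clique_on R C \<longleftrightarrow> (\<forall>i\<in>C. \<forall>j\<in>C. i < j \<longrightarrow> R i j)"

lemma clique_on_subset: "clique_on R C \<Longrightarrow> H \<subseteq> C \<Longrightarrow> clique_on R H"
  unfolding clique_on_def by blast

lemma clique_on_singleton [simp]: "clique_on R {x}"
  by (simp add: clique_on_def)

lemma clique_on_Un:
  assumes "clique_on R C" "clique_on R C'" "\<And>i j. i \<in> C \<Longrightarrow> j \<in> C' \<Longrightarrow> i < j \<and> R i j"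
  shows "clique_on R (C \<union> C')"
  using assms unfolding clique_on_def by (metis Un_iff less_asym')

text \<open>
  Tracking the product of a clique and an independent set, rather than their maximum, makes
  the recursion on halves additive: the factor that is completely joined gains, and the other
  factor does not decrease.
\<close>

lemma clique_times_independent:
  fixes R :: "nat \<Rightarrow> nat \<Rightarrow> bool" and \<epsilon> :: real
  assumes rect: "\<And>A B. finite A \<Longrightarrow> finite B \<Longrightarrow>
      has_rectangle \<epsilon> R A B \<or> has_rectangle \<epsilon> (\<lambda>i j. \<not> R i j) A B"
    and L: "1 \<le> \<epsilon> * real L" and \<epsilon>: "0 < \<epsilon>"
    and A: "finite A" "(2 * L) ^ m \<le> card A"
  obtains C I where "C \<subseteq> A" "I \<subseteq> A" "clique_on R C" "clique_on (\<lambda>i j. \<not> R i j) I"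
    "2 ^ m \<le> card C * card I"
proof -
  have "\<exists>C I. C \<subseteq> A \<and> I \<subseteq> A \<and> clique_on R C \<and> clique_on (\<lambda>i j. \<not> R i j) I \<and> 2 ^ m \<le> card C * card I"
    using A
  proof (induction m arbitrary: A)
    case 0
    then have "A \<noteq> {}" by auto
    then obtain x where "x \<in> A" by blast
    then show ?case by (intro exI[of _ "{x}"]) simp
  next
    case (Suc m)
    \<comment> \<open>This is half of \<open>(2 * L) ^ Suc m\<close>. Both parts of \<open>A\<close>
      have at least \<open>n\<close> elements, and since \<open>1 \<le> \<epsilon> * L\<close> an
      \<open>\<epsilon>\<close>-fraction of them still has \<open>(2 * L) ^ m\<close>.\<close>
    define n where "n = L * (2 * L) ^ m"
    have n: "2 * n \<le> card A" using Suc.prems(2) by (simp add: n_def mult_ac)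
    then obtain A1 where A1: "A1 \<subseteq> A" "card A1 = n" "\<forall>x\<in>A1. \<forall>y\<in>A - A1. x < y"
      using exists_initial_segment[OF Suc.prems(1), of n] by auto
    define A2 where "A2 = A - A1"
    have fin: "finite A1" "finite A2" using A1 Suc.prems finite_subset by (auto simp: A2_def)
    have A2: "n \<le> card A2" "A2 \<subseteq> A" using A1 n fin by (auto simp: A2_def card_Diff_subset)
    have less: "i < j" if "i \<in> A1" "j \<in> A2" for i j using that A1(3) by (auto simp: A2_def)
    have large: "(2 * L) ^ m \<le> k" if "n \<le> card S" "\<epsilon> * card S \<le> k" for k :: nat and S :: "nat set"
    proof -
      have "real ((2 * L) ^ m) = 1 * real ((2 * L) ^ m)" by simp
      also have "\<dots> \<le> (\<epsilon> * L) * real ((2 * L) ^ m)" using L by (intro mult_right_mono) auto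
      also have "\<dots> = \<epsilon> * real n" by (simp add: n_def)
      also have "\<dots> \<le> \<epsilon> * card S" using that \<epsilon> by (intro mult_left_mono) auto
      finally show ?thesis using that(2) by linarith
    qed
    have join: "card (X \<union> Y) = card X + card Y" if "X \<subseteq> A1" "Y \<subseteq> A2" for X Y
      using that fin by (intro card_Un_disjoint) (auto simp: A2_def intro: finite_subset)
    have larger: "2 ^ Suc m \<le> (c1 + c2) * max i1 i2" if "2 ^ m \<le> c1 * i1" "2 ^ m \<le> c2 * i2"
      for c1 c2 i1 i2 :: nat
    proof -
      have "2 ^ Suc m \<le> c1 * i1 + c2 * i2" using that by simp
      also have "\<dots> \<le> c1 * max i1 i2 + c2 * max i1 i2" by (intro add_mono mult_left_mono) auto
      finally show ?thesis by (simp add: algebra_simps)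
    qed
    \<comment> \<open>Stated for an arbitrary \<open>Q\<close>, so that it serves both for
      \<open>R\<close> and for its complement.\<close>
    have step: "\<exists>C I. C \<subseteq> A \<and> I \<subseteq> A \<and> clique_on Q C \<and> clique_on (\<lambda>i j. \<not> Q i j) I \<and>
        2 ^ Suc m \<le> card C * card I"
      if rect: "has_rectangle \<epsilon> Q A1 A2"
        and IH: "\<And>A. finite A \<Longrightarrow> (2 * L) ^ m \<le> card A \<Longrightarrow>
          \<exists>C I. C \<subseteq> A \<and> I \<subseteq> A \<and> clique_on Q C \<and> clique_on (\<lambda>i j. \<not> Q i j) I \<and> 2 ^ m \<le> card C * card I"
      for Q
    proof -
      obtain A' B' where sub: "A' \<subseteq> A1" "B' \<subseteq> A2"
        and card: "\<epsilon> * card A1 \<le> card A'" "\<epsilon> * card A2 \<le> card B'"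
        and Q: "\<And>i j. i \<in> A' \<Longrightarrow> j \<in> B' \<Longrightarrow> Q i j"
        using rect unfolding has_rectangle_def by blast
      have A': "finite A'" "(2 * L) ^ m \<le> card A'"
        using sub fin finite_subset large[OF _ card(1)] A1 by auto
      have B': "finite B'" "(2 * L) ^ m \<le> card B'"
        using sub fin finite_subset large[OF _ card(2)] A2 by auto
      obtain C1 I1 where 1: "C1 \<subseteq> A'" "I1 \<subseteq> A'" "clique_on Q C1" "clique_on (\<lambda>i j. \<not> Q i j) I1"
        "2 ^ m \<le> card C1 * card I1" using IH[OF A'] by blast
      obtain C2 I2 where 2: "C2 \<subseteq> B'" "I2 \<subseteq> B'" "clique_on Q C2" "clique_on (\<lambda>i j. \<not> Q i j) I2"
        "2 ^ m \<le> card C2 * card I2" using IH[OF B'] by blast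
      define I where "I = (if card I1 \<le> card I2 then I2 else I1)"
      have I: "card I = max (card I1) (card I2)" "clique_on (\<lambda>i j. \<not> Q i j) I" "I \<subseteq> A"
        using 1 2 sub A1 A2 by (auto simp: I_def)
      have "card (C1 \<union> C2) = card C1 + card C2" using join 1 2 sub by auto
      then have "2 ^ Suc m \<le> card (C1 \<union> C2) * card I"
        using larger[OF 1(5) 2(5)] I by simp
      moreover have "clique_on Q (C1 \<union> C2)"
        using 1 2 sub Q less by (intro clique_on_Un) blast+
      moreover have "C1 \<union> C2 \<subseteq> A" using 1 2 sub A1 A2 by auto
      ultimately show ?thesis using I by blast
    qed
    consider "has_rectangle \<epsilon> R A1 A2" | "has_rectangle \<epsilon> (\<lambda>i j. \<not> R i j) A1 A2"
      using rect fin by blast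
    then show ?case
    proof cases
      case 1
      show ?thesis by (rule step[OF 1 Suc.IH])
    next
      case 2
      \<comment> \<open>For the complement the clique and the independent set exchange roles; their
        product is symmetric.\<close>
      have "\<exists>C I. C \<subseteq> A \<and> I \<subseteq> A \<and> clique_on (\<lambda>i j. \<not> R i j) C \<and> clique_on (\<lambda>i j. \<not> \<not> R i j) I \<and>
          2 ^ Suc m \<le> card C * card I"
        by (rule step[OF 2]) (use Suc.IH in \<open>simp, metis mult.commute\<close>)
      then show ?thesis by (simp, metis mult.commute)
    qed
  qed
  then show ?thesis using that by blast
qed

definition pairs_constant :: "(nat \<Rightarrow> nat \<Rightarrow> bool) \<Rightarrow> nat set \<Rightarrow> bool" where
  "pairs_constant R H \<longleftrightarrow> clique_on R H \<or> clique_on (\<lambda>i j. \<not> R i j) H"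

text \<open>If the product of the sizes of a clique and an independent set is at least
  \<open>n * n\<close>, one of them has at least \<open>n\<close> elements.\<close>

lemma dot_pairs_ramsey:
  "\<exists>\<kappa>\<ge>1. \<forall>n A a b. finite A \<longrightarrow> n ^ \<kappa> \<le> card A \<longrightarrow>
     (\<exists>H\<subseteq>A. card H = n \<and> pairs_constant (\<lambda>i j. 0 \<le> dot D (a i) (b j)) H)"
proof -
  obtain \<epsilon> :: real where \<epsilon>: "0 < \<epsilon>" "\<epsilon> \<le> 1"
    "\<And>(a :: nat \<Rightarrow> nat \<Rightarrow> real) (b :: nat \<Rightarrow> nat \<Rightarrow> real) A B. finite A \<Longrightarrow> finite B \<Longrightarrow>
      has_rectangle \<epsilon> (\<lambda>i j. 0 \<le> dot D (a i) (b j)) A B \<or>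
      has_rectangle \<epsilon> (\<lambda>i j. \<not> 0 \<le> dot D (a i) (b j)) A B"
    using has_homogeneous_rectangle[of D] by blast
  define L where "L = nat \<lceil>1 / \<epsilon>\<rceil>"
  have "1 / \<epsilon> \<le> real L" unfolding L_def by linarith
  then have L: "1 \<le> \<epsilon> * real L" using \<epsilon> by (simp add: field_simps)
  then have "L \<noteq> 0" by (intro notI) simp
  \<comment> \<open>The \<open>3\<close> comes from \<open>2 ^ (m + 1) \<le> n ^ 3\<close>, the
    \<open>2 * L\<close> from \<open>2 * L \<le> 2 ^ (2 * L)\<close>.\<close>
  define \<kappa> where "\<kappa> = 3 * (2 * L)"
  have "\<exists>H\<subseteq>A. card H = n \<and> pairs_constant (\<lambda>i j. 0 \<le> dot D (a i) (b j)) H"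
    if A: "finite A" "n ^ \<kappa> \<le> card A" for n A and a b :: "nat \<Rightarrow> nat \<Rightarrow> real"
  proof (cases "n \<le> 1")
    case True
    then consider "n = 0" | "n = 1" by linarith
    then show ?thesis
    proof cases
      case 1
      then show ?thesis by (intro exI[of _ "{}"]) (simp add: pairs_constant_def clique_on_def)
    next
      case 2
      then have "A \<noteq> {}" using A by auto
      then obtain x where "x \<in> A" by blast
      then show ?thesis using 2 by (intro exI[of _ "{x}"]) (simp add: pairs_constant_def)
    qed
  next
    case False
    then have n: "2 \<le> n" by simp
    have "2 * 1 \<le> n * n" using n by (intro mult_mono) auto
    \<comment> \<open>\<open>2 ^ (m + 1)\<close> is the least power of two that reaches
      \<open>n * n\<close>.\<close>
    then obtain m where m: "2 ^ m < n * n" "n * n \<le> 2 ^ (m + 1)"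
      using ex_power_ivl2[of 2 "n * n"] by auto
    have "2 ^ (m + 1) \<le> 2 * (n * n)" using m by simp
    also have "\<dots> \<le> n * (n * n)" using n by (intro mult_right_mono) auto
    finally have 2: "2 ^ (m + 1) \<le> n ^ 3" by (simp add: power3_eq_cube mult.assoc)
    have "(2 * L) ^ (m + 1) \<le> (2 ^ (2 * L)) ^ (m + 1)"
      by (intro power_mono) (auto intro: less_imp_le of_nat_less_two_power less_exp)
    also have "\<dots> = (2 ^ (m + 1)) ^ (2 * L)" by (simp only: power_mult[symmetric] mult.commute)
    also have "\<dots> \<le> (n ^ 3) ^ (2 * L)" using 2 by (intro power_mono) auto
    also have "\<dots> = n ^ \<kappa>" by (simp add: \<kappa>_def power_mult)
    finally have large: "(2 * L) ^ (m + 1) \<le> card A" using A by linarith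
    obtain C I where CI: "C \<subseteq> A" "I \<subseteq> A" "clique_on (\<lambda>i j. 0 \<le> dot D (a i) (b j)) C"
      "clique_on (\<lambda>i j. \<not> 0 \<le> dot D (a i) (b j)) I" "2 ^ (m + 1) \<le> card C * card I"
      by (rule clique_times_independent[OF \<epsilon>(3) L \<epsilon>(1) A(1) large])
    have "n \<le> card C \<or> n \<le> card I"
    proof (rule ccontr)
      assume "\<not> ?thesis"
      then have "card C * card I < n * n" by (intro mult_strict_mono) auto
      then show False using CI m by linarith
    qed
    then show ?thesis
    proof
      assume "n \<le> card C"
      then obtain H where "H \<subseteq> C" "card H = n" using obtain_subset_with_card_n by blast
      then show ?thesis using CI(1,3) clique_on_subset unfolding pairs_constant_def by blast
    next
      assume "n \<le> card I"
      then obtain H where "H \<subseteq> I" "card H = n" using obtain_subset_with_card_n by blast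
      then show ?thesis using CI(2,4) clique_on_subset unfolding pairs_constant_def by blast
    qed
  qed
  moreover have "1 \<le> \<kappa>" using \<open>L \<noteq> 0\<close> by (simp add: \<kappa>_def)
  ultimately show ?thesis by blast
qed

section \<open>Counting sign patterns\<close>

text \<open>As \<open>y\<close> varies these are the traces on \<open>C\<close> of the half-spaces
  with normal \<open>y\<close>, so the size of the range is a shatter function.\<close>

definition sign_pattern :: "nat \<Rightarrow> (nat \<Rightarrow> real) set \<Rightarrow> (nat \<Rightarrow> real) \<Rightarrow> (nat \<Rightarrow> real) set" where
  "sign_pattern D C y = {c\<in>C. 0 \<le> dot D c y}"

text \<open>On \<open>S\<close> the map \<open>f\<close> factors through \<open>g\<close>.\<close>

lemma card_image_le_of_determined:
  assumes "finite (g ` S)" and det: "\<And>x y. x \<in> S \<Longrightarrow> y \<in> S \<Longrightarrow> g x = g y \<Longrightarrow> f x = f y"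
  shows "finite (f ` S)" "card (f ` S) \<le> card (g ` S)"
proof -
  define h where "h z = f (SOME x. x \<in> S \<and> g x = z)" for z
  have "h (g x) = f x" if "x \<in> S" for x
  proof -
    have "\<exists>x'. x' \<in> S \<and> g x' = g x" using that by blast
    then have "(SOME x'. x' \<in> S \<and> g x' = g x) \<in> S \<and> g (SOME x'. x' \<in> S \<and> g x' = g x) = g x"
      by (rule someI_ex)
    then show ?thesis unfolding h_def using det that by blast
  qed
  then have "f ` S = h ` g ` S" by (force simp: image_iff)
  then show "finite (f ` S)" "card (f ` S) \<le> card (g ` S)"
    using assms(1) by (auto intro: card_image_le)
qed

text \<open>Sets closed downwards along a real-valued function, each relative to the other, are
  nested; equal size then forces equality.\<close>

lemma down_sets_of_same_card_eq:
  fixes h :: "'a \<Rightarrow> real"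
  assumes "finite U" "finite V" "card U = card V"
    and U: "\<And>x y. x \<in> U \<Longrightarrow> y \<in> V \<Longrightarrow> h y \<le> h x \<Longrightarrow> y \<in> U"
    and V: "\<And>x y. x \<in> V \<Longrightarrow> y \<in> U \<Longrightarrow> h y \<le> h x \<Longrightarrow> y \<in> V"
  shows "U = V"
proof -
  have "U \<subseteq> V \<or> V \<subseteq> U"
  proof (rule ccontr)
    assume "\<not> ?thesis"
    then obtain x y where "x \<in> U" "x \<notin> V" "y \<in> V" "y \<notin> U" by blast
    then show False using U[of x y] V[of y x] linorder_linear[of "h x" "h y"] by blast
  qed
  then show ?thesis using assms by (metis card_subset_eq)
qed

text \<open>
  Eliminating the last coordinate: once the order of the thresholds \<open>- dot D c y / c D\<close> at \<open>y\<close> is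
  known, which of them lie below \<open>y D\<close> is determined by how many do.
\<close>

lemma sign_pattern_Suc_determined:
  fixes C :: "(nat \<Rightarrow> real) set" and D :: nat
  defines "Z \<equiv> {c\<in>C. c D = 0} \<union> (\<lambda>(c, c') m. c m / c D - c' m / c' D) ` (C \<times> C)"
  assumes C: "finite C"
    and Z: "sign_pattern D Z y = sign_pattern D Z z"
    and pos: "card {c \<in> sign_pattern (Suc D) C y. 0 < c D} = card {c \<in> sign_pattern (Suc D) C z. 0 < c D}"
    and neg: "card {c \<in> sign_pattern (Suc D) C y. c D < 0} = card {c \<in> sign_pattern (Suc D) C z. c D < 0}"
  shows "sign_pattern (Suc D) C y = sign_pattern (Suc D) C z"
proof -
  define h where "h x c = - dot D c x / c D" for x c
  \<comment> \<open>\<open>Z\<close> contains the normalised difference of every pair of vectors.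
    Vectors with \<open>c D = 0\<close> fit in as well, since division by \<open>0\<close> gives
    \<open>0\<close> on both sides.\<close>
  have order: "h y c \<le> h y c' \<longleftrightarrow> h z c \<le> h z c'" if "c \<in> C" "c' \<in> C" for c c'
  proof -
    have "(\<lambda>m. c m / c D - c' m / c' D) \<in> Z" using that unfolding Z_def by force
    then have "0 \<le> dot D (\<lambda>m. c m / c D - c' m / c' D) y \<longleftrightarrow> 0 \<le> dot D (\<lambda>m. c m / c D - c' m / c' D) z"
      using Z by (auto simp: sign_pattern_def set_eq_iff)
    then show ?thesis by (simp add: dot_diff_divide_left h_def)
  qed
  have mono: "h z c \<le> h z c'" if "h y c \<le> h y c'" "c \<in> C" "c' \<in> C" for c c'
    using order that by simp
  have p: "0 \<le> dot (Suc D) c x \<longleftrightarrow> h x c \<le> x D" if "0 < c D" for c x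
    using that by (simp add: h_def dot_Suc field_simps) linarith
  have n: "0 \<le> dot (Suc D) c x \<longleftrightarrow> x D \<le> h x c" if "c D < 0" for c x
    using that by (simp add: h_def dot_Suc field_simps) linarith
  have fin: "finite {c \<in> sign_pattern (Suc D) C x. P c}" for x P
    using C by (simp add: sign_pattern_def)
  have 1: "{c \<in> sign_pattern (Suc D) C y. 0 < c D} = {c \<in> sign_pattern (Suc D) C z. 0 < c D}"
    by (rule down_sets_of_same_card_eq[OF fin fin pos, where h = "h y"])
      (auto simp: sign_pattern_def p intro: order_trans dest: mono)
  \<comment> \<open>For negative \<open>c D\<close> the vectors in the pattern have thresholds at or
    above \<open>y D\<close>; the sign of \<open>h\<close> is changed to obtain down-sets.\<close>
  have 2: "{c \<in> sign_pattern (Suc D) C y. c D < 0} = {c \<in> sign_pattern (Suc D) C z. c D < 0}"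
    by (rule down_sets_of_same_card_eq[OF fin fin neg, where h = "\<lambda>c. - h y c"])
      (auto simp: sign_pattern_def n intro: order_trans dest: mono)
  have 3: "0 \<le> dot (Suc D) c y \<longleftrightarrow> 0 \<le> dot (Suc D) c z" if "c \<in> C" "c D = 0" for c
  proof -
    have "c \<in> Z" using that by (auto simp: Z_def)
    then show ?thesis using Z that by (auto simp: sign_pattern_def set_eq_iff dot_Suc)
  qed
  have "c \<in> sign_pattern (Suc D) C y \<longleftrightarrow> c \<in> sign_pattern (Suc D) C z" for c
    using 1 2 3[of c] by (cases "c D" "0 :: real" rule: linorder_cases) (auto simp: sign_pattern_def set_eq_iff)
  then show ?thesis by blast
qed

text \<open>A pattern in dimension \<open>Suc D\<close> is determined by a pattern of the at most
  \<open>s + s * s\<close> vectors of \<open>Z\<close> in dimension \<open>D\<close> and two counts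
  up to \<open>s\<close>. As \<open>s + s * s + 2 \<le> (s + 2) ^ 2\<close>, the exponent grows from
  \<open>\<kappa>\<close> to \<open>2 + 2 * \<kappa>\<close>.\<close>

lemma card_sign_patterns:
  "\<exists>\<kappa>. \<forall>C s. finite C \<longrightarrow> card C \<le> s \<longrightarrow>
     finite (range (sign_pattern D C)) \<and> card (range (sign_pattern D C)) \<le> (s + 2) ^ \<kappa>"
proof (induction D)
  case 0
  have "range (sign_pattern 0 C) = {C}" for C by (auto simp: sign_pattern_def dot_def)
  then show ?case by (intro exI[of _ 0]) auto
next
  case (Suc D)
  then obtain \<kappa> where \<kappa>: "\<And>C s. finite C \<Longrightarrow> card C \<le> s \<Longrightarrow>
     finite (range (sign_pattern D C)) \<and> card (range (sign_pattern D C)) \<le> (s + 2) ^ \<kappa>" by blast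
  have "finite (range (sign_pattern (Suc D) C)) \<and> card (range (sign_pattern (Suc D) C)) \<le> (s + 2) ^ (2 + 2 * \<kappa>)"
    if C: "finite C" "card C \<le> s" for C s
  proof -
    define Z where "Z = {c\<in>C. c D = 0} \<union> (\<lambda>(c, c') m. c m / c D - c' m / c' D) ` (C \<times> C)"
    define g where "g y = (sign_pattern D Z y, card {c \<in> sign_pattern (Suc D) C y. 0 < c D},
      card {c \<in> sign_pattern (Suc D) C y. c D < 0})" for y
    have finZ: "finite Z" using C by (simp add: Z_def)
    have "card Z \<le> card {c\<in>C. c D = 0} + card ((\<lambda>(c, c') m. c m / c D - c' m / c' D) ` (C \<times> C))"
      unfolding Z_def by (rule card_Un_le)
    also have "\<dots> \<le> card C + card (C \<times> C)"
      using C by (intro add_mono card_mono card_image_le) auto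
    also have "\<dots> \<le> s + s * s" using C by (auto simp: card_cartesian_product intro!: add_mono mult_mono)
    finally have cardZ: "card Z \<le> s + s * s" .
    have cnt: "card {c \<in> sign_pattern (Suc D) C y. P c} \<in> {..s}" for y P
      using card_mono[OF C(1), of "{c \<in> sign_pattern (Suc D) C y. P c}"] C(2)
      by (auto simp: sign_pattern_def)
    let ?T = "range (sign_pattern D Z) \<times> {..s} \<times> {..s}"
    have sub: "range g \<subseteq> ?T"
    proof -
      have "g y \<in> ?T" for y unfolding g_def by (intro SigmaI rangeI cnt)
      then show ?thesis by blast
    qed
    have finT: "finite ?T" using \<kappa>[OF finZ cardZ] by simp
    have fing: "finite (range g)" using finite_subset[OF sub finT] .
    have det: "sign_pattern (Suc D) C y = sign_pattern (Suc D) C z" if "g y = g z" for y z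
      using that sign_pattern_Suc_determined[OF C(1), of D y z] by (simp add: g_def Z_def)
    have "card (range (sign_pattern (Suc D) C)) \<le> card (range g)"
      using card_image_le_of_determined(2)[OF fing, of "sign_pattern (Suc D) C"] det by blast
    also have "\<dots> \<le> card ?T" by (rule card_mono[OF finT sub])
    also have "\<dots> = card (range (sign_pattern D Z)) * ((s + 1) * (s + 1))"
      by (simp add: card_cartesian_product)
    also have "\<dots> \<le> (s + s * s + 2) ^ \<kappa> * ((s + 2) * (s + 2))"
      using \<kappa>[OF finZ cardZ] by (intro mult_mono) auto
    also have "\<dots> \<le> ((s + 2) ^ 2) ^ \<kappa> * ((s + 2) * (s + 2))"
      by (intro mult_right_mono power_mono) (auto simp: power2_eq_square algebra_simps)
    also have "\<dots> = (s + 2) ^ (2 + 2 * \<kappa>)" by (simp only: power_add power_mult power_mult_distrib power2_eq_square mult.commute)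
    finally have "card (range (sign_pattern (Suc D) C)) \<le> (s + 2) ^ (2 + 2 * \<kappa>)" .
    moreover have "finite (range (sign_pattern (Suc D) C))"
      using card_image_le_of_determined(1)[OF fing, of "sign_pattern (Suc D) C"] det by blast
    ultimately show ?thesis by blast
  qed
  then show ?case by blast
qed

section \<open>Multilinear functions and the Erdos-Rado step\<close>

text \<open>On lists of length \<open>k\<close>, \<open>f\<close> is a multilinear form in the
  vectors \<open>(\<phi> 0 x, ..., \<phi> (D - 1) x)\<close> of the entries. The recursion peels off
  the last entry, the one that the Erdos-Rado step varies.\<close>

primrec multilinear :: "nat \<Rightarrow> (nat \<Rightarrow> 'a \<Rightarrow> real) \<Rightarrow> nat \<Rightarrow> ('a list \<Rightarrow> real) \<Rightarrow> bool" where
  "multilinear D \<phi> 0 f \<longleftrightarrow> True"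
| "multilinear D \<phi> (Suc k) f \<longleftrightarrow>
     (\<exists>g. (\<forall>m<D. multilinear D \<phi> k (g m)) \<and>
          (\<forall>xs y. length xs = k \<longrightarrow> f (xs @ [y]) = dot D (\<lambda>m. g m xs) (\<lambda>m. \<phi> m y)))"

lemma multilinear_cong:
  assumes "multilinear D \<phi> k f" "\<And>xs. length xs = k \<Longrightarrow> f' xs = f xs"
  shows "multilinear D \<phi> k f'"
  using assms by (cases k) auto

lemma multilinear_sum:
  assumes "finite S" "\<And>s. s \<in> S \<Longrightarrow> multilinear D \<phi> k (f s)"
  shows "multilinear D \<phi> k (\<lambda>xs. \<Sum>s\<in>S. c s * f s xs)"
  using assms(2)
proof (induction k arbitrary: f)
  case (Suc k)
  then obtain g where g: "\<And>s m. s \<in> S \<Longrightarrow> m < D \<Longrightarrow> multilinear D \<phi> k (g s m)"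
    "\<And>s xs y. s \<in> S \<Longrightarrow> length xs = k \<Longrightarrow> f s (xs @ [y]) = dot D (\<lambda>m. g s m xs) (\<lambda>m. \<phi> m y)"
    by (simp only: multilinear.simps) metis
  have "(\<Sum>s\<in>S. c s * f s (xs @ [y])) = dot D (\<lambda>m. \<Sum>s\<in>S. c s * g s m xs) (\<lambda>m. \<phi> m y)"
    if "length xs = k" for xs y
  proof -
    have "(\<Sum>s\<in>S. c s * f s (xs @ [y])) = (\<Sum>s\<in>S. \<Sum>m<D. c s * g s m xs * \<phi> m y)"
      using g(2) that by (intro sum.cong) (auto simp: dot_def sum_distrib_left mult.assoc)
    also have "\<dots> = (\<Sum>m<D. \<Sum>s\<in>S. c s * g s m xs * \<phi> m y)" by (rule sum.swap)
    finally show ?thesis by (simp add: dot_def sum_distrib_right)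
  qed
  moreover have "multilinear D \<phi> k (\<lambda>xs. \<Sum>s\<in>S. c s * g s m xs)" if "m < D" for m
    by (rule Suc.IH) (use g that in auto)
  ultimately show ?case
    by (simp only: multilinear.simps) (rule exI[of _ "\<lambda>m xs. \<Sum>s\<in>S. c s * g s m xs"], blast)
qed simp

text \<open>With the last entry fixed, a linear combination of the coefficient forms remains; this
  lowers the arity in the Erdos-Rado step.\<close>

lemma multilinear_last:
  assumes "multilinear D \<phi> (Suc k) f"
  shows "multilinear D \<phi> k (\<lambda>xs. f (xs @ [y]))"
proof -
  obtain g where g: "\<And>m. m < D \<Longrightarrow> multilinear D \<phi> k (g m)"
    "\<And>xs y. length xs = k \<Longrightarrow> f (xs @ [y]) = dot D (\<lambda>m. g m xs) (\<lambda>m. \<phi> m y)"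
    using assms by auto
  have "multilinear D \<phi> k (\<lambda>xs. \<Sum>m<D. \<phi> m y * g m xs)"
    by (rule multilinear_sum) (use g in auto)
  then show ?thesis
    by (rule multilinear_cong) (simp add: g(2) dot_def mult.commute)
qed

lemma multilinear_prod:
  assumes "\<And>i. i < k \<Longrightarrow> \<exists>m<D. \<psi> i = \<phi> m"
  shows "multilinear D \<phi> k (\<lambda>xs. \<Prod>i<k. \<psi> i (xs ! i))"
  using assms
proof (induction k)
  case (Suc k)
  obtain m0 where m0: "m0 < D" "\<psi> k = \<phi> m0" using Suc.prems by blast
  \<comment> \<open>The indicator selects the single coordinate \<open>m0\<close> that the last
    factor uses.\<close>
  define g where "g m xs = (if m = m0 then 1 else 0) * (\<Prod>i<k. \<psi> i (xs ! i))" for m xs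
  have "multilinear D \<phi> k (g m)" if "m < D" for m
  proof -
    have "multilinear D \<phi> k (\<lambda>xs. \<Prod>i<k. \<psi> i (xs ! i))" using Suc by simp
    from multilinear_sum[of "{()}" D \<phi> k, OF _ this, of "\<lambda>_. if m = m0 then 1 else 0"]
    show ?thesis by (simp add: g_def[abs_def])
  qed
  moreover have "(\<Prod>i<Suc k. \<psi> i ((xs @ [y]) ! i)) = dot D (\<lambda>m. g m xs) (\<lambda>m. \<phi> m y)"
    if "length xs = k" for xs y
  proof -
    have "dot D (\<lambda>m. g m xs) (\<lambda>m. \<phi> m y) = (\<Sum>m<D. if m = m0 then (\<Prod>i<k. \<psi> i (xs ! i)) * \<phi> m y else 0)"
      unfolding dot_def g_def by (intro sum.cong) auto
    also have "\<dots> = (\<Prod>i<k. \<psi> i (xs ! i)) * \<phi> m0 y" using m0 by simp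
    also have "\<dots> = (\<Prod>i<Suc k. \<psi> i ((xs @ [y]) ! i))"
      using that m0 by (simp add: nth_append)
    finally show ?thesis ..
  qed
  ultimately show ?case by (auto intro!: exI[of _ g])
qed simp

section \<open>Increasing tuples and the Ramsey property for sign conditions\<close>

definition increasing_tuples :: "nat set \<Rightarrow> nat \<Rightarrow> nat list set" where
  "increasing_tuples H k = {xs. sorted_wrt (<) xs \<and> set xs \<subseteq> H \<and> length xs = k}"

text \<open>Each sign is constant separately, so every Boolean combination of the signs is constant
  too.\<close>

definition constant_signs :: "(nat list \<Rightarrow> real) list \<Rightarrow> nat set \<Rightarrow> nat \<Rightarrow> bool" where
  "constant_signs fs H k \<longleftrightarrow> (\<forall>f\<in>set fs. \<exists>v. \<forall>xs\<in>increasing_tuples H k. (0 \<le> f xs) = v)"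

lemma increasing_tuples_mono: "H \<subseteq> H' \<Longrightarrow> increasing_tuples H k \<subseteq> increasing_tuples H' k"
  by (auto simp: increasing_tuples_def)

lemma append_in_increasing_tuples:
  "xs @ [y] \<in> increasing_tuples H (Suc k) \<longleftrightarrow>
     xs \<in> increasing_tuples H k \<and> y \<in> H \<and> (\<forall>x\<in>set xs. x < y)"
  by (auto simp: increasing_tuples_def sorted_wrt_append)

lemma card_increasing_tuples:
  assumes "finite H"
  shows "finite (increasing_tuples H k)" "card (increasing_tuples H k) \<le> card H ^ k"
proof -
  have sub: "increasing_tuples H k \<subseteq> {xs. set xs \<subseteq> H \<and> length xs = k}"
    by (auto simp: increasing_tuples_def)
  have "finite {xs. set xs \<subseteq> H \<and> length xs = k}" using assms by (rule finite_lists_length_eq)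
  from finite_subset[OF sub this] card_mono[OF this sub] card_lists_length_eq[OF assms]
  show "finite (increasing_tuples H k)" "card (increasing_tuples H k) \<le> card H ^ k" by auto
qed

text \<open>Points appear only as indices, through \<open>\<phi>\<close>; quantifying over all
  finite \<open>A\<close> allows repeated passage to subsets.\<close>

definition sign_ramsey :: "nat \<Rightarrow> nat \<Rightarrow> nat \<Rightarrow> nat \<Rightarrow> nat \<Rightarrow> bool" where
  "sign_ramsey D t k n N \<longleftrightarrow>
     (\<forall>\<phi> fs A. length fs = t \<longrightarrow> (\<forall>f\<in>set fs. multilinear D \<phi> k f) \<longrightarrow> finite A \<longrightarrow> N \<le> card A \<longrightarrow>
        (\<exists>H\<subseteq>A. card H = n \<and> constant_signs fs H k))"

lemma sign_ramsey_mono: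
  assumes "sign_ramsey D t k n M" "M \<le> N"
  shows "sign_ramsey D t k n N"
  unfolding sign_ramsey_def
proof (intro allI impI)
  fix \<phi> :: "nat \<Rightarrow> nat \<Rightarrow> real" and fs :: "(nat list \<Rightarrow> real) list" and A :: "nat set"
  assume "length fs = t" "\<forall>f\<in>set fs. multilinear D \<phi> k f" "finite A" "N \<le> card A"
  moreover have "M \<le> card A" using assms(2) \<open>N \<le> card A\<close> by linarith
  ultimately show "\<exists>H\<subseteq>A. card H = n \<and> constant_signs fs H k"
    using assms(1) unfolding sign_ramsey_def by blast
qed

lemma sign_ramseyD:
  assumes "sign_ramsey D t k n N" "length fs = t" "\<forall>f\<in>set fs. multilinear D \<phi> k f" "finite A" "N \<le> card A"
  obtains H where "H \<subseteq> A" "card H = n" "constant_signs fs H k"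
  using assms unfolding sign_ramsey_def by blast

lemma multilinear_2:
  assumes "multilinear D \<phi> 2 f"
  obtains a where "\<And>i j. f [i, j] = dot D (a i) (\<lambda>m. \<phi> m j)"
proof -
  have "multilinear D \<phi> (Suc 1) f" using assms by (simp only: Suc_1)
  then obtain g where g: "\<And>xs y. length xs = 1 \<Longrightarrow> f (xs @ [y]) = dot D (\<lambda>m. g m xs) (\<lambda>m. \<phi> m y)"
    by (simp only: multilinear.simps(2)) blast
  have "f [i, j] = dot D (\<lambda>m. g m [i]) (\<lambda>m. \<phi> m j)" for i j using g[of "[i]" j] by simp
  then show ?thesis by (rule that)
qed

lemma pairs_constant_imp:
  assumes "pairs_constant (\<lambda>i j. 0 \<le> f [i, j]) H"
  shows "\<exists>v. \<forall>xs\<in>increasing_tuples H 2. (0 \<le> f xs) = v"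
proof -
  have "\<exists>i j. xs = [i, j] \<and> i \<in> H \<and> j \<in> H \<and> i < j" if "xs \<in> increasing_tuples H 2" for xs
    using that by (auto simp: increasing_tuples_def numeral_2_eq_2 length_Suc_conv)
  then show ?thesis using assms unfolding pairs_constant_def clique_on_def by metis
qed

text \<open>The functions are treated one after another; a sign made constant stays so on subsets,
  and each function costs one power \<open>\<kappa>\<close>, hence
  \<open>\<kappa> ^ t\<close>.\<close>

lemma sign_ramsey_pairs:
  obtains \<kappa> where "1 \<le> \<kappa>" "\<And>t n. sign_ramsey D t 2 n (n ^ (\<kappa> ^ t))"
proof -
  obtain \<kappa> where \<kappa>: "1 \<le> \<kappa>" "\<And>n A a b. finite A \<Longrightarrow> n ^ \<kappa> \<le> card A \<Longrightarrow>
     (\<exists>H\<subseteq>A. card H = n \<and> pairs_constant (\<lambda>i j. 0 \<le> dot D (a i) (b j)) H)"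
    using dot_pairs_ramsey[of D] by blast
  have "\<exists>H\<subseteq>A. card H = n \<and> constant_signs fs H 2"
    if "\<forall>f\<in>set fs. multilinear D \<phi> 2 f" "finite A" "n ^ (\<kappa> ^ length fs) \<le> card A" for \<phi> fs A n
    using that
  proof (induction fs arbitrary: A)
    case Nil
    then obtain H where "H \<subseteq> A" "card H = n" using obtain_subset_with_card_n[of n A] by auto
    then show ?case by (auto simp: constant_signs_def)
  next
    case (Cons f fs)
    obtain a where a: "\<And>i j. f [i, j] = dot D (a i) (\<lambda>m. \<phi> m j)"
      using multilinear_2[of D \<phi> f] Cons.prems(1) by auto
    have "(n ^ (\<kappa> ^ length fs)) ^ \<kappa> \<le> card A"
      using Cons.prems(3) by (simp add: power_mult[symmetric] mult.commute)
    then obtain A' where A': "A' \<subseteq> A" "card A' = n ^ (\<kappa> ^ length fs)"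
      "pairs_constant (\<lambda>i j. 0 \<le> f [i, j]) A'"
      using \<kappa>(2)[OF Cons.prems(2), where a = a and b = "\<lambda>j m. \<phi> m j"] unfolding a by blast
    then obtain H where H: "H \<subseteq> A'" "card H = n" "constant_signs fs H 2"
      using Cons.IH[of A'] Cons.prems finite_subset[of A' A] by auto
    have "\<exists>v. \<forall>xs\<in>increasing_tuples H 2. (0 \<le> f xs) = v"
      using pairs_constant_imp[OF A'(3)] increasing_tuples_mono[OF H(1), of 2] by blast
    then have "constant_signs (f # fs) H 2" using H(3) by (simp add: constant_signs_def)
    then show ?case using H A' by blast
  qed
  then have "sign_ramsey D t 2 n (n ^ (\<kappa> ^ t))" for t n unfolding sign_ramsey_def by blast
  then show ?thesis using that \<kappa>(1) by blast
qed

lemma large_fibre: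
  assumes "finite S" "card (g ` S) \<le> W" "W * (t - 1) < card S"
  obtains y where "y \<in> S" "t \<le> card {z\<in>S. g z = g y}"
proof (rule ccontr)
  assume "\<not> thesis"
  with that have small: "card {z\<in>S. g z = g y} \<le> t - 1" if "y \<in> S" for y using that by fastforce
  have "S = (\<Union>q\<in>g ` S. {z\<in>S. g z = q})" by blast
  then have "card S \<le> (\<Sum>q\<in>g ` S. card {z\<in>S. g z = q})"
    using card_UN_le[of "g ` S" "\<lambda>q. {z\<in>S. g z = q}"] assms(1) by simp
  also have "\<dots> \<le> of_nat (card (g ` S)) * (t - 1)"
    by (rule sum_bounded_above) (use small in auto)
  also have "\<dots> \<le> W * (t - 1)" using assms(2) by simp
  finally show False using assms(3) by simp
qed

text \<open>\<open>H\<close> holds the picked points and \<open>S\<close> the reservoir. Letting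
  \<open>z\<close> range over \<open>H\<close> too records that a later pick, as last entry, gives
  the same sign as any reservoir point.\<close>

definition end_homogeneous :: "(nat list \<Rightarrow> real) list \<Rightarrow> nat \<Rightarrow> nat set \<Rightarrow> nat set \<Rightarrow> bool" where
  "end_homogeneous fs k H S \<longleftrightarrow> (\<forall>x\<in>H. \<forall>s\<in>S. x < s) \<and>
     (\<forall>f\<in>set fs. \<forall>xs\<in>increasing_tuples H k. \<forall>z\<in>H \<union> S. \<forall>y\<in>S. (\<forall>x\<in>set xs. x < z) \<longrightarrow>
        (0 \<le> f (xs @ [z])) = (0 \<le> f (xs @ [y])))"

text \<open>The least reservoir point \<open>p\<close> is picked. For each tuple \<open>xs\<close>
  of picks, \<open>f (xs @ [z])\<close> is the inner product of a fixed vector with the vector of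
  \<open>z\<close>, so the rest of \<open>S\<close> falls into at most \<open>W\<close> sign
  patterns; a class with at least \<open>t\<close> points is kept.\<close>

lemma end_homogeneous_step:
  assumes patterns: "\<And>C s. finite C \<Longrightarrow> card C \<le> s \<Longrightarrow>
      finite (range (sign_pattern D C)) \<and> card (range (sign_pattern D C)) \<le> (s + 2) ^ \<kappa>"
    and fs: "\<forall>f\<in>set fs. multilinear D \<phi> (Suc k) f"
    and fin: "finite H" "finite S" and M: "card H < M"
    and W: "W = (length fs * M ^ k + 2) ^ \<kappa>"
    and hom: "end_homogeneous fs k H S" and S: "2 * W * t \<le> card S" "1 \<le> t"
  obtains p S' where "p \<in> S" "p \<notin> H" "S' \<subseteq> S" "t \<le> card S'" "end_homogeneous fs k (insert p H) S'"
proof -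
  have W1: "1 \<le> W" by (simp add: W)
  have "1 \<le> W * t" using W1 S(2) by simp
  then have "S \<noteq> {}" using S by auto
  define p where "p = Min S"
  have p: "p \<in> S" "\<And>s. s \<in> S \<Longrightarrow> p \<le> s" unfolding p_def using fin \<open>S \<noteq> {}\<close> by auto
  have pH: "p \<notin> H" "\<And>x. x \<in> H \<Longrightarrow> x < p" using hom p(1) by (auto simp: end_homogeneous_def)
  have "\<exists>g. \<forall>f\<in>set fs. \<forall>xs y. length xs = k \<longrightarrow> f (xs @ [y]) = dot D (g f xs) (\<lambda>m. \<phi> m y)"
  proof -
    have "\<exists>g. \<forall>xs y. length xs = k \<longrightarrow> f (xs @ [y]) = dot D (g xs) (\<lambda>m. \<phi> m y)" if f: "f \<in> set fs" for f
    proof -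
      obtain g where "\<And>xs y. length xs = k \<Longrightarrow> f (xs @ [y]) = dot D (\<lambda>m. g m xs) (\<lambda>m. \<phi> m y)"
        using fs f by auto
      then show ?thesis by (intro exI[of _ "\<lambda>xs m. g m xs"]) auto
    qed
    then show ?thesis by metis
  qed
  then obtain g where g: "\<And>f xs y. f \<in> set fs \<Longrightarrow> length xs = k \<Longrightarrow>
      f (xs @ [y]) = dot D (g f xs) (\<lambda>m. \<phi> m y)" by blast
  define C where "C = (\<lambda>(f, xs). g f xs) ` (set fs \<times> increasing_tuples (insert p H) k)"
  have finH': "finite (insert p H)" using fin by simp
  have finC: "finite C" unfolding C_def using card_increasing_tuples[OF finH'] by simp
  have "card C \<le> card (set fs \<times> increasing_tuples (insert p H) k)"
    unfolding C_def using card_increasing_tuples[OF finH'] by (intro card_image_le) simp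
  also have "\<dots> \<le> length fs * card (insert p H) ^ k"
    unfolding card_cartesian_product
    using card_increasing_tuples[OF finH'] by (intro mult_mono card_length) auto
  also have "\<dots> \<le> length fs * M ^ k"
    using fin M pH by (intro mult_left_mono power_mono) auto
  finally have cardC: "card C \<le> length fs * M ^ k" .
  define h where "h z = sign_pattern D C (\<lambda>m. \<phi> m z)" for z
  have "h ` (S - {p}) \<subseteq> range (sign_pattern D C)" by (auto simp: h_def)
  then have "card (h ` (S - {p})) \<le> card (range (sign_pattern D C))"
    using patterns[OF finC cardC] by (intro card_mono) auto
  then have "card (h ` (S - {p})) \<le> W" using patterns[OF finC cardC] by (simp add: W)
  moreover have "W * (t - 1) < card (S - {p})"
  proof -
    have "W * (t - 1) + W = W * t" using S(2) by (cases t) auto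
    \<comment> \<open>The factor \<open>2\<close> in the size of \<open>S\<close> pays for the
      removal of \<open>p\<close>.\<close>
    then have "W * (t - 1) + 2 \<le> 2 * (W * t)" using W1 \<open>1 \<le> W * t\<close> by linarith
    then show ?thesis using S(1) fin p(1) by simp
  qed
  ultimately obtain y0 where y0: "y0 \<in> S - {p}" "t \<le> card {z\<in>S - {p}. h z = h y0}"
    using large_fibre[of "S - {p}" h W t] fin by blast
  define S' where "S' = {z\<in>S - {p}. h z = h y0}"
  have "(0 \<le> f (xs @ [z])) = (0 \<le> f (xs @ [y]))"
    if f: "f \<in> set fs" and xs: "xs \<in> increasing_tuples (insert p H) k"
      and z: "z \<in> insert p H \<union> S'" "\<forall>x\<in>set xs. x < z" and y: "y \<in> S'" for f xs z y
  proof (cases "z \<in> S'")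
    case True
    have len: "length xs = k" using xs by (simp add: increasing_tuples_def)
    have "g f xs \<in> C" using f xs by (force simp: C_def)
    moreover have "h z = h y" using True y by (simp add: S'_def)
    ultimately show ?thesis using g[OF f len] by (auto simp: h_def sign_pattern_def set_eq_iff)
  next
    case False
    then have "z \<in> insert p H" using z by simp
    \<comment> \<open>No pick exceeds \<open>p\<close>, so a tuple before \<open>z\<close> avoids
      \<open>p\<close>. It is then covered by the old hypothesis, in which \<open>p\<close> counted
      as a reservoir point.\<close>
    then have "p \<notin> set xs" using z(2) pH(2) by force
    then have "xs \<in> increasing_tuples H k" using xs by (auto simp: increasing_tuples_def)
    moreover have "z \<in> H \<union> S" using \<open>z \<in> insert p H\<close> p by auto
    moreover have "y \<in> S" using y by (simp add: S'_def)
    ultimately show ?thesis using hom f z(2) unfolding end_homogeneous_def by blast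
  qed
  moreover have "x < s" if "x \<in> insert p H" "s \<in> S'" for x s
    using that p(2)[of s] pH(2)[of x] by (auto simp: S'_def less_le)
  ultimately have "end_homogeneous fs k (insert p H) S'" unfolding end_homogeneous_def by blast
  moreover have "S' \<subseteq> S" "t \<le> card S'" using y0 by (auto simp: S'_def)
  ultimately show ?thesis using that p pH by blast
qed

text \<open>After \<open>M\<close> picks a reservoir point \<open>y\<close> is left. Fixing
  \<open>y\<close> as last entry gives functions of arity \<open>k\<close>, to which the Ramsey
  property for \<open>M\<close> points applies; any last entry in \<open>H\<close> behaves like
  \<open>y\<close>.\<close>

lemma sign_ramsey_Suc:
  obtains \<kappa> where "\<And>t k n M. 1 \<le> k \<Longrightarrow> sign_ramsey D t k n M \<Longrightarrow>
    sign_ramsey D t (Suc k) n ((2 * (t * M ^ k + 2) ^ \<kappa>) ^ M)"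
proof -
  obtain \<kappa> where \<kappa>: "\<And>C s. finite C \<Longrightarrow> card C \<le> s \<Longrightarrow>
      finite (range (sign_pattern D C)) \<and> card (range (sign_pattern D C)) \<le> (s + 2) ^ \<kappa>"
    using card_sign_patterns[of D] by blast
  have "\<exists>H\<subseteq>A. card H = n \<and> constant_signs fs H (Suc k)"
    if k: "1 \<le> k" and ramsey: "sign_ramsey D (length fs) k n M"
      and fs: "\<forall>f\<in>set fs. multilinear D \<phi> (Suc k) f" and A: "finite A"
      "(2 * (length fs * M ^ k + 2) ^ \<kappa>) ^ M \<le> card A" for k n M \<phi> fs A
  proof -
    define W where "W = (length fs * M ^ k + 2) ^ \<kappa>"
    have "\<exists>H S. H \<union> S \<subseteq> A \<and> card H = r \<and> (2 * W) ^ (M - r) \<le> card S \<and> end_homogeneous fs k H S"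
      if "r \<le> M" for r
      using that
    proof (induction r)
      case 0
      \<comment> \<open>For \<open>k = 0\<close> the empty list would be a tuple and would already
        constrain \<open>A\<close>.\<close>
      have "increasing_tuples {} k = {}" using k by (auto simp: increasing_tuples_def)
      then have "end_homogeneous fs k {} A" by (simp add: end_homogeneous_def)
      then show ?case using A(2) by (intro exI[of _ "{}"] exI[of _ A]) (simp add: W_def)
    next
      case (Suc r)
      then obtain H S where HS: "H \<union> S \<subseteq> A" "card H = r" "(2 * W) ^ (M - r) \<le> card S"
        "end_homogeneous fs k H S" by auto
      have fin: "finite H" "finite S" using HS(1) A(1) finite_subset by auto
      have "M - r = Suc (M - Suc r)" using Suc.prems by simp
      then have "2 * W * (2 * W) ^ (M - Suc r) \<le> card S" using HS(3) by simp
      moreover have "1 \<le> (2 * W) ^ (M - Suc r)" by (simp add: W_def)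
      moreover have "card H < M" using HS(2) Suc.prems by simp
      ultimately obtain p S' where "p \<in> S" "p \<notin> H" "S' \<subseteq> S" "(2 * W) ^ (M - Suc r) \<le> card S'"
        "end_homogeneous fs k (insert p H) S'"
        using end_homogeneous_step[OF \<kappa> fs fin _ W_def HS(4)] by blast
      then show ?case using HS fin by (intro exI[of _ "insert p H"] exI[of _ S']) auto
    qed
    from this[of M] obtain H0 S where H0: "H0 \<union> S \<subseteq> A" "card H0 = M" "1 \<le> card S"
      "end_homogeneous fs k H0 S" by auto
    then have "S \<noteq> {}" by auto
    then obtain y where y: "y \<in> S" by blast
    define fs' where "fs' = map (\<lambda>f xs. f (xs @ [y])) fs"
    have "\<forall>f\<in>set fs'. multilinear D \<phi> k f"
      using fs by (auto simp: fs'_def simp del: multilinear.simps intro: multilinear_last)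
    moreover have "finite H0" "length fs' = length fs" using H0 A(1) finite_subset by (auto simp: fs'_def)
    ultimately obtain H where H: "H \<subseteq> H0" "card H = n" "constant_signs fs' H k"
      using ramsey H0(2) unfolding sign_ramsey_def by (metis order_refl)
    have "constant_signs fs H (Suc k)"
      unfolding constant_signs_def
    proof
      fix f assume f: "f \<in> set fs"
      then have "(\<lambda>xs. f (xs @ [y])) \<in> set fs'" by (simp add: fs'_def)
      from bspec[OF H(3)[unfolded constant_signs_def] this]
      obtain v where v: "\<And>xs. xs \<in> increasing_tuples H k \<Longrightarrow> (0 \<le> f (xs @ [y])) = v" by blast
      have "(0 \<le> f zs) = v" if zs: "zs \<in> increasing_tuples H (Suc k)" for zs
      proof -
        obtain xs z where eq: "zs = xs @ [z]" using zs by (cases zs rule: rev_cases) (auto simp: increasing_tuples_def)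
        have *: "xs \<in> increasing_tuples H k" "z \<in> H" "\<forall>x\<in>set xs. x < z"
          using zs by (auto simp: eq append_in_increasing_tuples)
        then have "(0 \<le> f (xs @ [z])) = (0 \<le> f (xs @ [y]))"
          using H0(4) f y H(1) increasing_tuples_mono[OF H(1), of k] unfolding end_homogeneous_def by blast
        then show ?thesis using v * by (simp add: eq)
      qed
      then show "\<exists>v. \<forall>xs\<in>increasing_tuples H (Suc k). (0 \<le> f xs) = v" by blast
    qed
    then show ?thesis using H H0 by blast
  qed
  then have "sign_ramsey D t (Suc k) n ((2 * (t * M ^ k + 2) ^ \<kappa>) ^ M)"
    if "1 \<le> k" "sign_ramsey D t k n M" for t k n M
    using that unfolding sign_ramsey_def[of D t "Suc k"] by blast
  then show ?thesis by (rule that)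
qed

section \<open>Tower bounds\<close>

lemma mult_le_power:
  fixes T :: real
  assumes "2 \<le> T" "1 \<le> e"
  shows "T * real e \<le> T ^ e"
  using assms(2)
proof (induction e rule: nat_induct_at_least)
  case (Suc e)
  have "T * real (Suc e) = T * real e + T * 1" by (simp add: algebra_simps)
  also have "\<dots> \<le> T * real e + T * real e" using Suc assms by (intro add_left_mono mult_left_mono) auto
  also have "\<dots> = 2 * (T * real e)" by simp
  also have "\<dots> \<le> T * T ^ e" using Suc assms by (intro mult_mono) auto
  finally show ?case by simp
qed simp

lemma twr_ge_2: "2 \<le> twr (Suc j) x" if "2 \<le> x"
proof (induction j)
  case (Suc j)
  have "(2::real) powr 1 \<le> 2 powr twr (Suc j) x" using Suc by (intro powr_mono) auto
  then show ?case by simp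
qed (use that in simp)

text \<open>An outer power moves inside: one level down it is only a factor \<open>e\<close>, and
  \<open>T * e \<le> T ^ e\<close> for \<open>T\<close> at least \<open>2\<close>.\<close>

lemma twr_power_le:
  assumes "2 \<le> x" "1 \<le> e"
  shows "twr (Suc j) x ^ e \<le> twr (Suc j) (x ^ e)"
proof (induction j)
  case (Suc j)
  have "twr (Suc (Suc j)) x ^ e = 2 powr (twr (Suc j) x * e)"
    by (simp add: powr_powr[symmetric] powr_realpow)
  also have "\<dots> \<le> 2 powr (twr (Suc j) x ^ e)"
    using mult_le_power[OF twr_ge_2[OF assms(1)] assms(2)] by (intro powr_mono) auto
  also have "\<dots> \<le> 2 powr (twr (Suc j) (x ^ e))" using Suc by (intro powr_mono) auto
  finally show ?case by simp
qed simp

lemma twr_nonneg: "0 \<le> x \<Longrightarrow> 0 \<le> twr (Suc j) x"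
  by (cases j) auto

lemma twr_1_ge: "1 \<le> twr (Suc j) 1"
proof (induction j)
  case (Suc j)
  have "(2::real) powr 0 \<le> 2 powr twr (Suc j) 1" using Suc by (intro powr_mono) auto
  then show ?case by simp
qed simp

text \<open>With \<open>t\<close>, \<open>k\<close> and \<open>\<kappa>\<close> fixed, the base is
  at most \<open>M ^ q\<close> and thus at most \<open>2 ^ (M * q)\<close>; raising it to the power
  \<open>M\<close> keeps a single exponential of a power of \<open>M\<close>.\<close>

lemma step_bound_le:
  fixes M t k \<kappa> :: nat
  assumes "2 \<le> M" "1 \<le> k"
  shows "(2 * (t * M ^ k + 2) ^ \<kappa>) ^ M \<le> 2 ^ (M ^ ((t + k + 1) * \<kappa> + 3))"
proof -
  define q where "q = (t + k + 1) * \<kappa> + 1"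
  have pow: "a \<le> M ^ a" for a
    using less_exp[of a] power_mono[OF assms(1), of a] by linarith
  have "t * M ^ k \<le> M ^ (t + k)" unfolding power_add using pow by (intro mult_right_mono) auto
  moreover have "2 \<le> M ^ (t + k)" using power_increasing[of 1 "t + k" M] assms by simp
  ultimately have "t * M ^ k + 2 \<le> 2 * M ^ (t + k)" by simp
  also have "\<dots> \<le> M ^ (t + k + 1)" using assms by simp
  finally have "2 * (t * M ^ k + 2) ^ \<kappa> \<le> M * (M ^ (t + k + 1)) ^ \<kappa>"
    using assms by (intro mult_mono power_mono) auto
  also have "\<dots> = M ^ q" by (simp only: q_def Suc_eq_plus1[symmetric] power_Suc power_mult)
  also have "\<dots> \<le> (2 ^ M) ^ q" by (intro power_mono) (auto intro: less_imp_le[OF less_exp])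
  finally have "(2 * (t * M ^ k + 2) ^ \<kappa>) ^ M \<le> ((2 ^ M) ^ q) ^ M" by (intro power_mono) auto
  also have "\<dots> = 2 ^ (M * M * q)" by (simp only: power_mult[symmetric] mult.assoc mult.commute mult.left_commute)
  also have "\<dots> \<le> 2 ^ (M * M * M ^ q)" using pow by (intro power_increasing mult_left_mono) auto
  also have "M * M * M ^ q = M ^ (2 + q)" by (simp only: power_add power2_eq_square)
  also have "2 + q = (t + k + 1) * \<kappa> + 3" by (simp add: q_def)
  finally show ?thesis .
qed

text \<open>Pairs give a polynomial, which is the first tower level. Each further arity adds one
  exponential and multiplies the exponent of \<open>n\<close> by a constant
  \<open>e\<close>.\<close>

lemma sign_ramsey_tower:
  assumes "2 \<le> k"
  shows "\<exists>c\<ge>1. \<forall>n\<ge>2. \<exists>N. sign_ramsey D t k n N \<and> real N \<le> twr (k - 1) (real n ^ c)"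
  using assms
proof (induction k rule: nat_induct_at_least)
  case base
  obtain \<kappa> where \<kappa>: "1 \<le> \<kappa>" "\<And>t n. sign_ramsey D t 2 n (n ^ (\<kappa> ^ t))" using sign_ramsey_pairs by blast
  have "sign_ramsey D t 2 n (n ^ (\<kappa> ^ t)) \<and> real (n ^ (\<kappa> ^ t)) \<le> twr (2 - 1) (real n ^ (\<kappa> ^ t))" for n
    using \<kappa> by simp
  then show ?case using \<kappa>(1) by (intro exI[of _ "\<kappa> ^ t"]) (blast intro: one_le_power)
next
  case (Suc k)
  then obtain j where j: "k - 1 = Suc j" "k = Suc (Suc j)" by (metis Suc_diff_le diff_Suc_1 le_Suc_ex add_2_eq_Suc)
  obtain c where c: "1 \<le> c" "\<And>n. 2 \<le> n \<Longrightarrow> \<exists>N. sign_ramsey D t k n N \<and> real N \<le> twr (Suc j) (real n ^ c)"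
    using Suc.IH j(1) by auto
  obtain \<kappa> where \<kappa>: "\<And>t k n M. 1 \<le> k \<Longrightarrow> sign_ramsey D t k n M \<Longrightarrow>
    sign_ramsey D t (Suc k) n ((2 * (t * M ^ k + 2) ^ \<kappa>) ^ M)" using sign_ramsey_Suc by blast
  define e where "e = (t + k + 1) * \<kappa> + 3"
  have "\<exists>N. sign_ramsey D t (Suc k) n N \<and> real N \<le> twr (Suc k - 1) (real n ^ (c * e))" if n: "2 \<le> n" for n
  proof -
    obtain N where N: "sign_ramsey D t k n N" "real N \<le> twr (Suc j) (real n ^ c)" using c(2) n by blast
    \<comment> \<open>\<open>step_bound_le\<close> asks for \<open>2 \<le> M\<close>; the tower
      bound survives because the tower is at least \<open>2\<close>.\<close>
    define M where "M = max N 2"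
    have "(2::real) ^ 1 \<le> 2 ^ c" using c(1) by (intro power_increasing) auto
    also have "\<dots> \<le> real n ^ c" using n by (intro power_mono) auto
    finally have nc: "2 \<le> real n ^ c" by simp
    have M: "sign_ramsey D t k n M" "2 \<le> M" "real M \<le> twr (Suc j) (real n ^ c)"
      using sign_ramsey_mono[OF N(1)] N(2) twr_ge_2[OF nc, of j] by (auto simp: M_def)
    define N' where "N' = (2 * (t * M ^ k + 2) ^ \<kappa>) ^ M"
    have "1 \<le> k" using j(2) by simp
    then have "N' \<le> 2 ^ (M ^ e)" unfolding N'_def e_def by (rule step_bound_le[OF M(2)])
    then have "real N' \<le> real (2 ^ (M ^ e))" by (rule of_nat_mono)
    also have "\<dots> = 2 powr (real M ^ e)" by (simp add: powr_realpow[symmetric])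
    also have "\<dots> \<le> 2 powr (twr (Suc j) (real n ^ c) ^ e)"
      using M(3) by (intro powr_mono power_mono) auto
    also have "\<dots> \<le> 2 powr (twr (Suc j) ((real n ^ c) ^ e))"
      using twr_power_le[OF nc, of e j] by (intro powr_mono) (auto simp: e_def)
    also have "\<dots> = twr (Suc k - 1) (real n ^ (c * e))" by (simp add: j(2) power_mult)
    finally show ?thesis using \<kappa>[OF _ M(1)] j(2) by (auto simp: N'_def)
  qed
  moreover have "1 \<le> c * e" using c(1) by (simp add: e_def)
  ultimately show ?case by blast
qed

section \<open>Semi-algebraic relations\<close>

text \<open>Each monomial is regrouped by points; absent variables enter with exponent
  \<open>0\<close>.\<close>

lemma mpoly_eval_eq_prod:
  fixes p :: "(nat \<times> 'd::finite) mpoly"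
  assumes "mpoly_vars p \<subseteq> {..<k} \<times> UNIV"
  shows "mpoly_eval (\<lambda>(i, j). (xs ! i) $ j) p =
    (\<Sum>m\<in>Poly_Mapping.keys p. Poly_Mapping.lookup p m *
       (\<Prod>i<k. \<Prod>j\<in>UNIV. (xs ! i) $ j ^ Poly_Mapping.lookup m (i, j)))"
  unfolding mpoly_eval_def
proof (intro sum.cong refl arg_cong2[where f = "(*)"])
  fix m assume m: "m \<in> Poly_Mapping.keys p"
  let ?F = "\<lambda>v. (case v of (i, j) \<Rightarrow> (xs ! i) $ j) ^ Poly_Mapping.lookup m v"
  have "Poly_Mapping.keys m \<subseteq> {..<k} \<times> UNIV" using m assms unfolding mpoly_vars_def by blast
  then have "(\<Prod>v\<in>Poly_Mapping.keys m. ?F v) = (\<Prod>v\<in>{..<k} \<times> UNIV. ?F v)"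
    by (intro prod.mono_neutral_left) (auto simp: in_keys_iff)
  also have "\<dots> = (\<Prod>i<k. \<Prod>j\<in>UNIV. (xs ! i) $ j ^ Poly_Mapping.lookup m (i, j))"
    by (simp add: prod.cartesian_product case_prod_beta)
  finally show "(\<Prod>v\<in>Poly_Mapping.keys m. ?F v) =
    (\<Prod>i<k. \<Prod>j\<in>UNIV. (xs ! i) $ j ^ Poly_Mapping.lookup m (i, j))" .
qed

lemma lookup_le_mpoly_degree:
  assumes "m \<in> Poly_Mapping.keys p"
  shows "Poly_Mapping.lookup m v \<le> mpoly_degree p"
proof -
  have "Poly_Mapping.lookup m v \<le> (\<Sum>v\<in>Poly_Mapping.keys m. Poly_Mapping.lookup m v)"
  proof (cases "v \<in> Poly_Mapping.keys m")
    case True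
    then show ?thesis by (intro member_le_sum) auto
  qed (simp add: in_keys_iff)
  also have "\<dots> \<le> mpoly_degree p" unfolding mpoly_degree_def using assms by (intro Max_ge) auto
  finally show ?thesis .
qed

text \<open>The \<open>\<phi> m\<close> are the monomials of one point with every exponent at most
  \<open>t\<close>. There are finitely many, whatever the polynomial, and the part of any monomial
  that belongs to one point is among them.\<close>

lemma mpoly_eval_multilinear:
  obtains D and \<phi> :: "nat \<Rightarrow> real ^ 'd::finite \<Rightarrow> real" where
    "\<And>(p :: (nat \<times> 'd) mpoly) k P. mpoly_vars p \<subseteq> {..<k} \<times> UNIV \<Longrightarrow> mpoly_degree p \<le> t \<Longrightarrow>
       multilinear D (\<lambda>m i. \<phi> m (P ! i)) k (\<lambda>is. mpoly_eval (\<lambda>(i, j). (map ((!) P) is ! i) $ j) p)"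
proof -
  define Ex where "Ex = {e :: 'd \<Rightarrow> nat. \<forall>j. e j \<le> t}"
  have "finite Ex"
    using finite_set_of_finite_funs[of "UNIV :: 'd set" "{..t}" 0] by (simp add: Ex_def)
  then obtain h where h: "bij_betw h {0..<card Ex} Ex" using ex_bij_betw_nat_finite by blast
  define \<phi> :: "nat \<Rightarrow> real ^ 'd \<Rightarrow> real" where "\<phi> m x = (\<Prod>j\<in>UNIV. x $ j ^ h m j)" for m x
  have "multilinear (card Ex) (\<lambda>m i. \<phi> m (P ! i)) k (\<lambda>is. mpoly_eval (\<lambda>(i, j). (map ((!) P) is ! i) $ j) p)"
    if vars: "mpoly_vars p \<subseteq> {..<k} \<times> UNIV" and deg: "mpoly_degree p \<le> t"
    for p :: "(nat \<times> 'd) mpoly" and k P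
  proof (rule multilinear_cong)
    let ?\<psi> = "\<lambda>m i l. \<Prod>j\<in>UNIV. (P ! l) $ j ^ Poly_Mapping.lookup m (i, j)"
    show "multilinear (card Ex) (\<lambda>m i. \<phi> m (P ! i)) k
      (\<lambda>is. \<Sum>m\<in>Poly_Mapping.keys p. Poly_Mapping.lookup p m * (\<Prod>i<k. ?\<psi> m i (is ! i)))"
    proof (rule multilinear_sum[OF finite_keys multilinear_prod])
      fix m i assume m: "m \<in> Poly_Mapping.keys p"
      have "(\<lambda>j. Poly_Mapping.lookup m (i, j)) \<in> Ex"
        using lookup_le_mpoly_degree[OF m] deg by (auto simp: Ex_def intro: order_trans)
      then have "(\<lambda>j. Poly_Mapping.lookup m (i, j)) \<in> h ` {0..<card Ex}" using h by (simp add: bij_betw_def)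
      then obtain m0 where "m0 < card Ex" "h m0 = (\<lambda>j. Poly_Mapping.lookup m (i, j))" by auto
      then show "\<exists>m0<card Ex. ?\<psi> m i = (\<lambda>l. \<phi> m0 (P ! l))"
        by (intro exI[of _ m0]) (simp add: \<phi>_def)
    qed
    fix "is" :: "nat list" assume "length is = k"
    then show "mpoly_eval (\<lambda>(i, j). (map ((!) P) is ! i) $ j) p =
        (\<Sum>m\<in>Poly_Mapping.keys p. Poly_Mapping.lookup p m * (\<Prod>i<k. ?\<psi> m i (is ! i)))"
      by (simp add: mpoly_eval_eq_prod[OF vars])
  qed
  then show ?thesis by (rule that)
qed

lemma ktuples_map_nth:
  assumes "finite H" "xs \<in> ktuples (map ((!) P) (sorted_list_of_set H)) k"
  obtains "is" where "is \<in> increasing_tuples H k" "xs = map ((!) P) is"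
proof -
  obtain K where K: "xs = nths (map ((!) P) (sorted_list_of_set H)) K" "length xs = k"
    using assms(2) by (auto simp: ktuples_def subseq_conv_nths)
  define js where "js = nths (sorted_list_of_set H) K"
  have eq: "xs = map ((!) P) js" by (simp add: K js_def nths_map)
  have "sorted_wrt (<) js"
    unfolding js_def strict_sorted_iff using sorted_nths by (simp add: sorted_nths)
  moreover have "set js \<subseteq> H" using set_nths_subset[of "sorted_list_of_set H" K] assms(1) by (simp add: js_def)
  moreover have "length js = k" using K(2) unfolding K(1)[symmetric] eq by simp
  ultimately have "js \<in> increasing_tuples H k" by (simp add: increasing_tuples_def)
  then show ?thesis using that eq by blast
qed

lemma subseq_map_nth:
  assumes "H \<subseteq> {..<length P}"
  shows "subseq (map ((!) P) (sorted_list_of_set H)) P"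
proof -
  define l where "l = filter (\<lambda>i. i \<in> H) [0..<length P]"
  have "set l = H" using assms by (auto simp: l_def)
  moreover have "sorted l" "distinct l" by (auto simp: l_def sorted_wrt_filter)
  ultimately have "sorted_list_of_set H = l" using sorted_list_of_set.idem_if_sorted_distinct by blast
  then have "sorted_list_of_set H = filter (\<lambda>i. i \<in> H) [0..<length P]" by (simp add: l_def)
  then have "subseq (sorted_list_of_set H) [0..<length P]" by simp
  then have "subseq (map ((!) P) (sorted_list_of_set H)) (map ((!) P) [0..<length P])" by (rule subseq_map)
  then show ?thesis by (simp add: map_nth)
qed

text \<open>On the tuples from \<open>H\<close> each polynomial has one constant sign, so
  \<open>\<Phi>\<close> always receives the same list \<open>map v fs\<close> and membership in
  \<open>E\<close> does not vary.\<close>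

lemma semialg_ramsey_bound_of_sign_ramsey:
  "\<exists>D. \<forall>k n N. sign_ramsey D t k n N \<longrightarrow> semialg_ramsey_bound TYPE('d::finite) t k n N"
proof -
  obtain D and \<phi> :: "nat \<Rightarrow> real ^ 'd \<Rightarrow> real" where \<phi>:
    "\<And>(p :: (nat \<times> 'd) mpoly) k P. mpoly_vars p \<subseteq> {..<k} \<times> UNIV \<Longrightarrow> mpoly_degree p \<le> t \<Longrightarrow>
       multilinear D (\<lambda>m i. \<phi> m (P ! i)) k (\<lambda>is. mpoly_eval (\<lambda>(i, j). (map ((!) P) is ! i) $ j) p)"
    using mpoly_eval_multilinear by blast
  have "n \<le> hom_size k P E"
    if ramsey: "sign_ramsey D t k n N" and P: "length P = N" and E: "semialg_relation k t P E"
    for k n N and P :: "(real ^ 'd) list" and E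
  proof -
    obtain fs :: "(nat \<times> 'd) mpoly list" and \<Phi> where fs: "length fs = t"
      "\<And>f. f \<in> set fs \<Longrightarrow> mpoly_vars f \<subseteq> {..<k} \<times> UNIV" "\<And>f. f \<in> set fs \<Longrightarrow> mpoly_degree f \<le> t"
      "\<And>xs. xs \<in> ktuples P k \<Longrightarrow> xs \<in> E \<longleftrightarrow> xs \<in> semialg_set k fs \<Phi>"
      using E unfolding semialg_relation_def by blast
    define F where "F f is = mpoly_eval (\<lambda>(i, j). (map ((!) P) is ! i) $ j) f"
      for f :: "(nat \<times> 'd) mpoly" and "is"
    have "\<forall>f\<in>set (map F fs). multilinear D (\<lambda>m i. \<phi> m (P ! i)) k f"
      using \<phi> fs(2,3) by (auto simp: F_def[abs_def])
    then obtain H where H: "H \<subseteq> {..<N}" "card H = n" "constant_signs (map F fs) H k"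
      using sign_ramseyD[OF ramsey, of "map F fs" _ "{..<N}"] fs(1) by auto
    define S where "S = map ((!) P) (sorted_list_of_set H)"
    have finH: "finite H" using H(1) finite_subset by blast
    have sub: "subseq S P" unfolding S_def using H(1) P by (intro subseq_map_nth) simp
    have "length S = n" by (simp add: S_def H(2))
    have "\<forall>f\<in>set fs. \<exists>v. \<forall>is\<in>increasing_tuples H k. (0 \<le> F f is) = v"
      using H(3) by (simp add: constant_signs_def)
    from bchoice[OF this]
    obtain v where v: "\<And>f is. f \<in> set fs \<Longrightarrow> is \<in> increasing_tuples H k \<Longrightarrow> (0 \<le> F f is) = v f" by blast
    have mem: "xs \<in> E \<longleftrightarrow> \<Phi> (map v fs)" if xs: "xs \<in> ktuples S k" for xs
    proof -
      obtain "is" where "is": "is \<in> increasing_tuples H k" "xs = map ((!) P) is"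
        using ktuples_map_nth[OF finH] xs unfolding S_def by blast
      have xsP: "xs \<in> ktuples P k" using xs sub by (auto simp: ktuples_def intro: subseq_order.order_trans)
      have len: "length xs = k" using xs by (simp add: ktuples_def)
      have signs: "map (\<lambda>f. mpoly_eval (\<lambda>(i, j). (xs ! i) $ j) f \<ge> 0) fs = map v fs"
        using v[OF _ "is"(1)] by (simp add: F_def "is"(2))
      show ?thesis using fs(4)[OF xsP] unfolding semialg_set_def mem_Collect_eq len signs by simp
    qed
    have "homogeneous k E S" using mem unfolding homogeneous_def by blast
    then show ?thesis using hom_size_ge[OF sub] \<open>length S = n\<close> by simp
  qed
  then have "semialg_ramsey_bound TYPE('d) t k n N" if "sign_ramsey D t k n N" for k n N
    using that unfolding semialg_ramsey_bound_def by blast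
  then show ?thesis by blast
qed

section \<open>The values \<open>n = 0\<close> and \<open>n = 1\<close>, where powers of
  \<open>n\<close> do not grow\<close>

lemma semialg_ramsey_0: "semialg_ramsey TYPE('d::finite) t k 0 = 0"
proof -
  have "semialg_ramsey_bound TYPE('d) t k 0 0" by (simp add: semialg_ramsey_bound_def)
  then show ?thesis unfolding semialg_ramsey_def by (rule Least_eq_0)
qed

text \<open>A single point has no \<open>k\<close>-tuples for \<open>k\<close> at least
  \<open>2\<close>, so it is homogeneous for every relation.\<close>

lemma semialg_ramsey_1_le:
  assumes "2 \<le> k"
  shows "semialg_ramsey TYPE('d::finite) t k 1 \<le> 1"
  unfolding semialg_ramsey_def
proof (rule Least_le)
  have "1 \<le> hom_size k P E" if "length P = 1" for P :: "(real ^ 'd) list" and E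
  proof -
    have "ktuples P k = {}" using that assms by (auto simp: ktuples_def dest: list_emb_length)
    then have "homogeneous k E P" by (simp add: homogeneous_def)
    then show ?thesis using hom_size_ge[of P P k E] that by simp
  qed
  then show "semialg_ramsey_bound TYPE('d) t k 1 1" by (simp add: semialg_ramsey_bound_def)
qed

theorem theorem1:
  fixes k t :: nat
  assumes "k \<ge> 2" and "t \<ge> 1"
  shows "\<exists>c\<^sub>1::real. \<forall>n::nat.
           real (semialg_ramsey TYPE('d::finite) t k n) \<le> twr (k - 1) (real n powr c\<^sub>1)"
proof -
  obtain D where D: "\<And>k n N. sign_ramsey D t k n N \<Longrightarrow> semialg_ramsey_bound TYPE('d::finite) t k n N"
    using semialg_ramsey_bound_of_sign_ramsey[where 'd = 'd, of t] by blast
  obtain c where c: "\<And>n. 2 \<le> n \<Longrightarrow> \<exists>N. sign_ramsey D t k n N \<and> real N \<le> twr (k - 1) (real n ^ c)"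
    using sign_ramsey_tower[OF assms(1), of D t] by blast
  obtain j where j: "k = Suc (Suc j)" using assms(1) by (metis le_Suc_ex add_2_eq_Suc)
  have "real (semialg_ramsey TYPE('d) t k n) \<le> twr (k - 1) (real n powr real c)" for n
  proof -
    consider "n = 0" | "n = 1" | "2 \<le> n" by linarith
    then show ?thesis
    proof cases
      case 1
      \<comment> \<open>Since \<open>0 powr c\<close> is \<open>0\<close>, the right-hand side
        vanishes for \<open>k = 2\<close>, and the exact value \<open>0\<close> on the left is
        required.\<close>
      then show ?thesis using twr_nonneg[of 0 j] by (simp add: semialg_ramsey_0 j)
    next
      case 2
      then show ?thesis using semialg_ramsey_1_le[OF assms(1), where 'd = 'd, of t] twr_1_ge[of j] by (simp add: j)
    next
      case 3
      then obtain N where N: "sign_ramsey D t k n N" "real N \<le> twr (k - 1) (real n ^ c)" using c by blast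
      have "semialg_ramsey TYPE('d) t k n \<le> N"
        unfolding semialg_ramsey_def using D[OF N(1)] by (rule Least_le)
      moreover have "real n powr real c = real n ^ c" using 3 by (simp add: powr_realpow)
      ultimately show ?thesis using N(2) by simp
    qed
  qed
  then show ?thesis by blast
qed

end
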